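(* Let $n\ge2$, $m\ge1$, $k\ge0$ be integers, and let $N^m(k)$ denote the $k$-th $m$-Narayana number of type $A_{n-1}$. Then $N^m(k)$ equals the number of partitions $\lambda$ such that $\lambda$ is both an $n$-core and an $(mn+1)$-core and there exists $K\subseteq\mathbb{Z}/n\mathbb{Z}$ with $|K|=k$ such that, for $i\in\mathbb{Z}/n\mathbb{Z}$, $\lambda$ has exactly $m$ removable boxes of residue $i$ if and only if $i\in K$.
   Context: Let $V=\{(a_1,\dots,a_n)\in\mathbb{R}^n\mid \sum_i a_i=0\}$ with the standard inner product $\langle\cdot\mid\cdot\rangle$ of $\mathbb{R}^n$ and standard basis vectors $\varepsilon_i$; $\Delta^+=\{\varepsilon_i-\varepsilon_j\mid 1\le i<j\le n\}$, $\alpha_i=\varepsilon_i-\varepsilon_{i+1}$, $\theta=\varepsilon_1-\varepsilon_n$, and $H_{\alpha,k}=\{v\in V\mid\langle v\mid\alpha\rangle=k\}$. The fundamental alcove is $\mathcal{A}_0=\{v\in V\mid \langle v\mid\alpha_i\rangle>0\ (1\le i\le n-1),\ \langle v\mid\theta\rangle<1\}$. The $m$-Shi arrangement is $\{H_{\alpha,k}\mid\alpha\in\Delta^+,\ -m<k\le m\}$; its regions are the connected components of the complement in $V$ of the union of these hyperplanes, and a region is dominant if it lies in the dominant chamber $\{v\in V\mid\langle v\mid\alpha_i\rangle\ge0,\ 1\le i\le n-1\}$. The $k$-th $m$-Narayana number $N^m(k)$ (of type $A_{n-1}$) is the number of dominant regions of the $m$-Shi arrangement for which there are exactly $k$ hyperplanes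 of the form $H_{\alpha,m}$, $\alpha\in\Delta^+$, that separate the region from $\mathcal{A}_0$ and contain a wall (facet) of the region. Partitions are identified with their Young diagrams $\{(i,j)\mid1\le j\le\lambda_i\}$. For a positive integer $t$, a partition is a $t$-core if none of its hook lengths is divisible by $t$. The residue of a box $(i,j)$ is $(j-i)\bmod n$. A box of $\lambda$ is removable if deleting it leaves a partition. *)

theory Defs
  imports "HOL-Analysis.Analysis"
begin

text \<open>
  The coordinates \<open>1, \<dots>, n\<close> are the elements of a finite linearly ordered type \<open>'n\<close>
  with \<open>n = CARD('n)\<close>, listed in increasing order.
\<close>

definition V_space :: "(real ^ 'n) set" where
  "V_space = {v. (\<Sum>i\<in>UNIV. v $ i) = 0}"

definition eps :: "'n \<Rightarrow> real ^ 'n" where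
  "eps i = axis i 1"

definition positive_roots :: "(real ^ 'n::{finite,linorder}) set" where
  "positive_roots = {eps i - eps j | i j. i < j}"

text \<open>The condition on \<open>i\<close> and \<open>j\<close> says that \<open>j\<close> is the immediate successor of \<open>i\<close>.\<close>

definition simple_roots :: "(real ^ 'n::{finite,linorder}) set" where
  "simple_roots = {eps i - eps j | i j. i < j \<and> \<not> (\<exists>l. i < l \<and> l < j)}"

definition highest_root :: "real ^ 'n::{finite,linorder}" where
  "highest_root = eps (Min UNIV) - eps (Max UNIV)"

definition root_hyperplane :: "real ^ 'n \<Rightarrow> int \<Rightarrow> (real ^ 'n) set" where
  "root_hyperplane a k = {v \<in> V_space. v \<bullet> a = of_int k}"

definition fundamental_alcove :: "(real ^ 'n::{finite,linorder}) set" where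
  "fundamental_alcove =
     {v \<in> V_space. (\<forall>a\<in>simple_roots. v \<bullet> a > 0) \<and> v \<bullet> highest_root < 1}"

definition dominant_chamber :: "(real ^ 'n::{finite,linorder}) set" where
  "dominant_chamber = {v \<in> V_space. \<forall>a\<in>simple_roots. v \<bullet> a \<ge> 0}"

definition shi_arrangement :: "nat \<Rightarrow> (real ^ 'n::{finite,linorder}) set set" where
  "shi_arrangement m =
     {root_hyperplane a k | a k. a \<in> positive_roots \<and> - int m < k \<and> k \<le> int m}"

definition shi_regions :: "nat \<Rightarrow> (real ^ 'n::{finite,linorder}) set set" where
  "shi_regions m = components (V_space - \<Union> (shi_arrangement m))"

definition dominant_shi_regions :: "nat \<Rightarrow> (real ^ 'n::{finite,linorder}) set set" where
  "dominant_shi_regions m = {R \<in> shi_regions m. R \<subseteq> dominant_chamber}"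

definition separates :: "real ^ 'n \<Rightarrow> int \<Rightarrow> (real ^ 'n) set \<Rightarrow> (real ^ 'n) set \<Rightarrow> bool" where
  "separates a k A B \<longleftrightarrow>
     (\<forall>x\<in>A. x \<bullet> a < of_int k) \<and> (\<forall>y\<in>B. y \<bullet> a > of_int k) \<or>
     (\<forall>x\<in>A. x \<bullet> a > of_int k) \<and> (\<forall>y\<in>B. y \<bullet> a < of_int k)"

definition contains_wall :: "(real ^ 'n) set \<Rightarrow> (real ^ 'n) set \<Rightarrow> bool" where
  "contains_wall H R \<longleftrightarrow> (\<exists>F. F facet_of closure R \<and> F \<subseteq> H)"

definition separating_walls ::
    "nat \<Rightarrow> (real ^ 'n::{finite,linorder}) set \<Rightarrow> (real ^ 'n::{finite,linorder}) set set" where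
  "separating_walls m R =
     {root_hyperplane a (int m) | a. a \<in> positive_roots \<and>
        separates a (int m) R fundamental_alcove \<and>
        contains_wall (root_hyperplane a (int m)) R}"

text \<open>The first argument only fixes \<open>n = CARD('n)\<close>: the type is \<open>A\<^bsub>n-1\<^esub>\<close>.\<close>

definition narayana :: "'n::{finite,linorder} itself \<Rightarrow> nat \<Rightarrow> nat \<Rightarrow> nat" where
  "narayana _ m k =
     card {R \<in> dominant_shi_regions m :: (real ^ 'n::{finite,linorder}) set set.
       card (separating_walls m R) = k}"

text \<open>A partition is the list of its nonzero parts; boxes are numbered from 1.\<close>

definition is_partition :: "nat list \<Rightarrow> bool" where
  "is_partition p \<longleftrightarrow> sorted_wrt (\<ge>) p \<and> 0 \<notin> set p"

definition diagram :: "nat list \<Rightarrow> (nat \<times> nat) set" where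
  "diagram p = {(i, j). 1 \<le> i \<and> i \<le> length p \<and> 1 \<le> j \<and> j \<le> p ! (i - 1)}"

definition hook_length :: "nat list \<Rightarrow> nat \<times> nat \<Rightarrow> nat" where
  "hook_length p = (\<lambda>(i, j).
     card {(a, b) \<in> diagram p. a = i \<and> b \<ge> j \<or> a \<ge> i \<and> b = j})"

definition is_core :: "nat \<Rightarrow> nat list \<Rightarrow> bool" where
  "is_core t p \<longleftrightarrow> is_partition p \<and> (\<forall>x\<in>diagram p. \<not> t dvd hook_length p x)"

definition residue :: "nat \<Rightarrow> nat \<times> nat \<Rightarrow> int" where
  "residue n = (\<lambda>(i, j). (int j - int i) mod int n)"

definition removable_boxes :: "nat list \<Rightarrow> (nat \<times> nat) set" where
  "removable_boxes p =
     {x \<in> diagram p. \<exists>q. is_partition q \<and> diagram q = diagram p - {x}}"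

end

theory Submission
  imports Defs
begin

text \<open>
  Both sides are counted by the same integer vectors. A \<^emph>\<open>window\<close> is a strictly decreasing
  function \<open>Y\<close> from the \<open>n\<close> coordinates to the integers with values in pairwise different residue
  classes modulo \<open>n\<close>; it is \<^emph>\<open>gap-bounded\<close> if \<open>Y i - Y j \<le> m n + 1\<close> whenever
  \<open>Y j \<equiv> Y i - 1\<close> modulo \<open>n\<close>. A pair \<open>(i, j)\<close> attaining this bound is called tight here.

  \<^emph>\<open>Partitions.\<close> A partition is encoded by its beads \<open>\<lambda>\<^sub>i - i\<close> for \<open>i \<ge> 1\<close>. It is a
  \<open>t\<close>-core exactly if its bead set is closed under subtracting \<open>t\<close>. The bead set of an \<open>n\<close>-core is
  therefore determined by the largest bead in each residue class, that is, by a window, and every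
  window is of this form after a unique translation. The partition is an \<open>(m n + 1)\<close>-core exactly
  if the window is gap-bounded. Removing a box moves a bead down by one, and the residue of the box
  is the class of that bead; if \<open>v\<close> is the coordinate with
  \<open>Y v \<equiv> Y u - 1\<close>, then the number of removable boxes of the residue of \<open>Y u\<close> is
  \<open>(Y u - 1 - Y v) / n\<close>, or \<open>0\<close> if this is negative. As \<open>m \<ge> 1\<close>, this number is \<open>m\<close> exactly if \<open>(u, v)\<close> is tight.

  \<^emph>\<open>Regions.\<close> The point \<open>Y / n\<close>, projected to \<open>V\<close>, lies in an alcove of the dominant chamber,
  and \<open>level Y i j\<close>, the integer part of \<open>(Y i - Y j) / n\<close>, tells between which two hyperplanes
  orthogonal to \<open>\<epsilon>\<^sub>i - \<epsilon>\<^sub>j\<close> it lies. A dominant region of the \<open>m\<close>-Shi arrangement is the set of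
  points whose levels, cut off at \<open>m\<close>, are prescribed. Every dominant region contains an alcove,
  hence a window. If the window is not gap-bounded, then crossing the wall between the two offending
  coordinates lowers a level that stays at least \<open>m\<close>, so it does not leave the region; as the sum
  of squares decreases, a gap-bounded window is reached (\<open>gap_bounded_representative\<close>).

  The key fact about a gap-bounded window (\<open>level_split\<close>) is that a difference
  \<open>Y i - Y j > m n + 1\<close> forces some \<open>l\<close> between \<open>i\<close> and \<open>j\<close> with
  \<open>level Y i j = level Y i l + level Y l j\<close>. It has two consequences. All levels of \<open>Y\<close> are lower
  bounds for the coordinate differences on the whole region, so the gap-bounded window of a region
  is unique up to translation (\<open>shi_cell_level_inject\<close>). And a hyperplane \<open>H\<close> with root
  \<open>\<epsilon>\<^sub>i - \<epsilon>\<^sub>j\<close> at height \<open>m\<close> that separates the region from the fundamental alcove contains a wall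
  of it exactly if \<open>(i, j)\<close> is tight: otherwise the inequality of \<open>H\<close> follows from those for
  \<open>(i, l)\<close> and \<open>(l, j)\<close>, so that \<open>H\<close> meets the closure in codimension at least two; and if the
  pair is tight, \<open>H\<close> passes so close to \<open>Y / n\<close> that no other hyperplane is in between.

  Hence cores correspond to dominant regions, and residues with exactly \<open>m\<close> removable boxes
  correspond, via tight pairs, to separating walls at height \<open>m\<close>.
\<close>

section \<open>Bead sets of partitions\<close>

text \<open>
  Padding with zeros makes the parts a function on all natural numbers, counted from
  \<open>0\<close>.
\<close>

definition row_length :: "nat list \<Rightarrow> nat \<Rightarrow> nat" where
  "row_length p i = (if i < length p then p ! i else 0)"

text \<open>
  The usual \<open>\<lambda>\<^sub>r - r\<close> for the row \<open>r = i + 1\<close>; here rows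
  are counted from \<open>0\<close>.
\<close>

definition bead :: "nat list \<Rightarrow> nat \<Rightarrow> int" where
  "bead p i = int (row_length p i) - int i - 1"

definition bead_set :: "nat list \<Rightarrow> int set" where
  "bead_set p = range (bead p)"

lemma row_length_antimono:
  assumes "is_partition p" "i \<le> j"
  shows "row_length p j \<le> row_length p i"
  using assms sorted_wrt_nth_less[of "(\<ge>)" p i j]
  by (cases "i = j") (auto simp: row_length_def is_partition_def)

lemma bead_strict_antimono:
  assumes "is_partition p" "i < j"
  shows "bead p j < bead p i"
  using row_length_antimono[of p i j] assms by (simp add: bead_def)

lemma row_length_pos_iff:
  assumes "is_partition p"
  shows "0 < row_length p i \<longleftrightarrow> i < length p"
  using assms nth_mem[of i p] by (cases "i < length p"; cases "p ! i") (auto simp: row_length_def is_partition_def)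

lemma partition_eqI:
  assumes "is_partition p" "is_partition q" "\<And>i. row_length p i = row_length q i"
  shows "p = q"
proof -
  have "length p = length q"
    using row_length_pos_iff[OF assms(1)] row_length_pos_iff[OF assms(2)] assms(3)
    by (metis linorder_neqE_nat less_irrefl)
  thus ?thesis
    using assms(3) by (intro nth_equalityI) (auto simp: row_length_def split: if_splits, metis)
qed

lemma mem_diagram_iff:
  "(a, b) \<in> diagram p \<longleftrightarrow> 1 \<le> a \<and> 1 \<le> b \<and> b \<le> row_length p (a - 1)"
  by (auto simp: diagram_def row_length_def)

text \<open>
  The witness \<open>c\<close> is the length of column \<open>j\<close>, the part
  \<open>\<lambda>\<^sup>T\<^sub>j\<close> of the conjugate partition.
\<close>

lemma column_height_exists:
  assumes "is_partition p" "1 \<le> j"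
  shows "\<exists>c. \<forall>a. j \<le> row_length p a \<longleftrightarrow> a < c"
proof -
  have ex: "row_length p (length p) < j" using assms by (simp add: row_length_def)
  define c where "c = (LEAST a. row_length p a < j)"
  have c: "row_length p c < j" unfolding c_def by (rule LeastI, rule ex)
  have "j \<le> row_length p a \<longleftrightarrow> a < c" for a
  proof
    assume "a < c"
    thus "j \<le> row_length p a" using not_less_Least[of a "\<lambda>a. row_length p a < j"] by (simp add: c_def)
  next
    assume "j \<le> row_length p a"
    thus "a < c" using c row_length_antimono[OF assms(1), of c a] by (cases "a < c") auto
  qed
  thus ?thesis by blast
qed

text \<open>
  Columns correspond to the integers that are not beads: rows above the foot of column
  \<open>j\<close> have beads above \<open>j - 1 - c\<close>, and all other rows have beads below
  it.
\<close>

lemma column_gap_notin_bead_set: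
  assumes "is_partition p" "\<And>a. j \<le> row_length p a \<longleftrightarrow> a < c"
  shows "int j - 1 - int c \<notin> bead_set p"
proof
  assume "int j - 1 - int c \<in> bead_set p"
  then obtain a where a: "int j - 1 - int c = int (row_length p a) - int a - 1"
    by (auto simp: bead_set_def bead_def)
  show False using assms(2)[of a] a by (cases "a < c") auto
qed

text \<open>
  The hook of a box runs along its row and its column, so its length is the distance from the
  bead of the row down to the gap of the column.
\<close>

lemma hook_length_eq_bead_diff:
  assumes "(i, j) \<in> diagram p" "\<And>a. j \<le> row_length p a \<longleftrightarrow> a < c"
  shows "int (hook_length p (i, j)) = bead p (i - 1) - (int j - 1 - int c)"
proof -
  have ij: "1 \<le> i" "1 \<le> j" "j \<le> row_length p (i - 1)"
    using assms(1) by (auto simp: mem_diagram_iff)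
  have ic: "i \<le> c" using assms(2)[of "i - 1"] ij by auto
  have "{(a, b) \<in> diagram p. a = i \<and> b \<ge> j \<or> a \<ge> i \<and> b = j}
      = Pair i ` {j..row_length p (i - 1)} \<union> (\<lambda>a. (a, j)) ` {i<..c}"
  proof (intro equalityI subsetI)
    fix x assume "x \<in> {(a, b) \<in> diagram p. a = i \<and> b \<ge> j \<or> a \<ge> i \<and> b = j}"
    then obtain a b where x: "x = (a, b)" and d: "1 \<le> a" "1 \<le> b" "b \<le> row_length p (a - 1)"
      and ab: "a = i \<and> b \<ge> j \<or> a \<ge> i \<and> b = j"
      by (auto simp: mem_diagram_iff)
    show "x \<in> Pair i ` {j..row_length p (i - 1)} \<union> (\<lambda>a. (a, j)) ` {i<..c}"
      using x d ab assms(2)[of "a - 1"] by (cases "a = i") auto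
  next
    fix x assume "x \<in> Pair i ` {j..row_length p (i - 1)} \<union> (\<lambda>a. (a, j)) ` {i<..c}"
    thus "x \<in> {(a, b) \<in> diagram p. a = i \<and> b \<ge> j \<or> a \<ge> i \<and> b = j}"
    proof
      assume "x \<in> Pair i ` {j..row_length p (i - 1)}"
      thus ?thesis using ij by (auto simp: mem_diagram_iff)
    next
      assume "x \<in> (\<lambda>a. (a, j)) ` {i<..c}"
      then obtain a where a: "x = (a, j)" "i < a" "a \<le> c" by auto
      have "j \<le> row_length p (a - 1)" using assms(2)[of "a - 1"] a ij by auto
      thus ?thesis using a ij by (auto simp: mem_diagram_iff)
    qed
  qed
  moreover have "card (Pair i ` {j..row_length p (i - 1)} \<union> (\<lambda>a. (a, j)) ` {i<..c})
      = (Suc (row_length p (i - 1)) - j) + (c - i)"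
    by (subst card_Un_disjoint) (auto simp: card_image inj_on_def)
  ultimately have "hook_length p (i, j) = (Suc (row_length p (i - 1)) - j) + (c - i)"
    by (simp add: hook_length_def)
  thus ?thesis using ij ic by (simp add: bead_def of_nat_diff)
qed

text \<open>
  Conversely each gap \<open>g\<close> belongs to a column: if exactly \<open>c\<close> beads lie
  above \<open>g\<close>, that column has length \<open>c\<close>.
\<close>

lemma gap_is_column_gap:
  assumes "is_partition p" "g \<notin> bead_set p"
  shows "\<exists>c j. 1 \<le> j \<and> g = int j - 1 - int c \<and> (\<forall>a. j \<le> row_length p a \<longleftrightarrow> a < c)"
proof -
  have ne: "bead p a \<noteq> g" for a using assms(2) by (auto simp: bead_set_def)
  define c where "c = (LEAST a. bead p a < g)"
  have "bead p (nat (\<bar>g\<bar>) + length p) < g"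
    by (simp add: bead_def row_length_def)
  hence c: "bead p c < g" unfolding c_def by (rule LeastI)
  have lt: "bead p a < g \<longleftrightarrow> c \<le> a" for a
  proof
    assume "bead p a < g" thus "c \<le> a" unfolding c_def by (rule Least_le)
  next
    assume "c \<le> a"
    thus "bead p a < g"
      using c bead_strict_antimono[OF assms(1), of c a] by (cases "c = a") auto
  qed
  define j where "j = nat (g + int c + 1)"
  have j: "int j = g + int c + 1" "1 \<le> j" using c by (auto simp: j_def bead_def)
  have "j \<le> row_length p a \<longleftrightarrow> a < c" for a
  proof (cases "a < c")
    case True
    hence "\<not> bead p (c - 1) < g" using lt[of "c - 1"] by simp
    hence "bead p (c - 1) > g" using ne[of "c - 1"] by simp
    hence "int (row_length p (c - 1)) \<ge> int j" using True j by (simp add: bead_def of_nat_diff)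
    moreover have "row_length p (c - 1) \<le> row_length p a"
      using True by (intro row_length_antimono[OF assms(1)]) simp
    ultimately show ?thesis using True by simp
  next
    case False
    have "int (row_length p c) < int j" using c j(1) by (simp add: bead_def)
    moreover have "row_length p a \<le> row_length p c"
      using False by (intro row_length_antimono[OF assms(1)]) simp
    ultimately show ?thesis using False by simp
  qed
  moreover have "g = int j - 1 - int c" using j(1) by simp
  ultimately show ?thesis using j(2) by blast
qed

lemma closed_under_multiples:
  fixes t :: nat and B :: "int set"
  assumes "\<forall>b\<in>B. b - int t \<in> B" "b \<in> B" "a \<le> b" "int t dvd b - a" "0 < t"
  shows "a \<in> B"
proof -
  obtain q where q: "b - a = int t * q" using assms(4) by auto
  have "0 \<le> int t * q" using q assms(3) by simp
  hence "0 \<le> q" using assms(5) by (simp add: zero_le_mult_iff)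
  have "b - int t * int k \<in> B" for k
  proof (induction k)
    case 0 show ?case using assms(2) by simp
  next
    case (Suc k)
    have "b - int t * int (Suc k) = (b - int t * int k) - int t" by (simp add: algebra_simps)
    thus ?case using Suc assms(1) by (metis)
  qed
  from this[of "nat q"] show ?thesis using q \<open>0 \<le> q\<close> by (simp add: algebra_simps)
qed

text \<open>
  A hook length is the distance from a bead to a lower gap. If it is a multiple of
  \<open>t\<close>, stepping down from the bead by \<open>t\<close> leaves the bead set on the
  way; and a single such step out of the bead set is a hook of length \<open>t\<close>.
\<close>

lemma is_core_iff_closed:
  assumes "0 < t"
  shows "is_core t p \<longleftrightarrow> is_partition p \<and> (\<forall>b\<in>bead_set p. b - int t \<in> bead_set p)"
proof (cases "is_partition p")
  case p: True
  have "(\<forall>x\<in>diagram p. \<not> t dvd hook_length p x) \<longleftrightarrow> (\<forall>b\<in>bead_set p. b - int t \<in> bead_set p)"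
  proof
    assume core: "\<forall>x\<in>diagram p. \<not> t dvd hook_length p x"
    show "\<forall>b\<in>bead_set p. b - int t \<in> bead_set p"
    proof (rule ballI, rule ccontr)
      fix b assume b: "b \<in> bead_set p" "b - int t \<notin> bead_set p"
      then obtain i where i: "b = bead p i" by (auto simp: bead_set_def)
      obtain c j where cj: "1 \<le> j" "b - int t = int j - 1 - int c"
        "\<And>a. j \<le> row_length p a \<longleftrightarrow> a < c"
        using gap_is_column_gap[OF p b(2)] by blast
      have "i < c"
      proof (rule ccontr)
        assume "\<not> i < c"
        hence "row_length p i < j" using cj(3)[of i] by auto
        thus False using cj(2) i \<open>\<not> i < c\<close> assms by (simp add: bead_def)
      qed
      hence d: "(Suc i, j) \<in> diagram p" using cj by (simp add: mem_diagram_iff)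
      have "int (hook_length p (Suc i, j)) = int t"
        using hook_length_eq_bead_diff[OF d cj(3)] cj(2) i by simp
      hence "hook_length p (Suc i, j) = t" by simp
      thus False using core d by (metis dvd_refl)
    qed
  next
    assume cl: "\<forall>b\<in>bead_set p. b - int t \<in> bead_set p"
    show "\<forall>x\<in>diagram p. \<not> t dvd hook_length p x"
    proof (rule ballI, rule notI)
      fix x assume x: "x \<in> diagram p" and dv: "t dvd hook_length p x"
      obtain i j where xij: "x = (i, j)" by fastforce
      have ij: "(i, j) \<in> diagram p" using x xij by simp
      obtain c where c: "\<And>a. j \<le> row_length p a \<longleftrightarrow> a < c"
        using column_height_exists[OF p, of j] ij by (auto simp: mem_diagram_iff)
      have h: "int (hook_length p x) = bead p (i - 1) - (int j - 1 - int c)"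
        using hook_length_eq_bead_diff[OF ij c] xij by simp
      have "int t dvd bead p (i - 1) - (int j - 1 - int c)"
        using dv unfolding h[symmetric] by simp
      moreover have "int j - 1 - int c \<le> bead p (i - 1)" using h by linarith
      moreover have "bead p (i - 1) \<in> bead_set p" by (simp add: bead_set_def)
      ultimately have "int j - 1 - int c \<in> bead_set p"
        using closed_under_multiples[OF cl _ _ _ assms] by metis
      thus False using column_gap_notin_bead_set[OF p c] by simp
    qed
  qed
  thus ?thesis using p by (simp add: is_core_def)
qed (simp add: is_core_def)

text \<open>By induction, the \<open>i\<close>-th value is the largest one that is not yet listed.\<close>

lemma strict_antimono_range_eq:
  fixes f g :: "nat \<Rightarrow> int"
  assumes "\<And>i j. i < j \<Longrightarrow> f j < f i" "\<And>i j. i < j \<Longrightarrow> g j < g i" "range f = range g"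
  shows "f i = g i"
proof (induction i rule: less_induct)
  case (less i)
  obtain a where a: "f i = g a" using assms(3) by (metis rangeE rangeI)
  obtain b where b: "g i = f b" using assms(3) by (metis rangeE rangeI)
  have "\<not> a < i" using less[of a] assms(1)[of a i] a by auto
  moreover have "\<not> b < i" using less[of b] assms(2)[of b i] b by auto
  moreover have "a = i \<or> g a < g i" using \<open>\<not> a < i\<close> assms(2)[of i a] by (cases "a = i") auto
  moreover have "b = i \<or> f b < f i" using \<open>\<not> b < i\<close> assms(1)[of i b] by (cases "b = i") auto
  ultimately show ?case using a b by auto
qed

text \<open>
  Far down, the \<open>i\<close>-th bead of any partition is \<open>- i - 1\<close>; this pins
  down the translation \<open>c\<close>.
\<close>

lemma bead_set_shift_inject:
  assumes "is_partition p" "is_partition q" "bead_set p = (\<lambda>b. b + c) ` bead_set q"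
  shows "p = q"
proof -
  have eq: "bead p i = bead q i + c" for i
    by (rule strict_antimono_range_eq[where g = "\<lambda>i. bead q i + c"])
       (use assms in \<open>auto simp: bead_strict_antimono bead_set_def image_image\<close>)
  have "c = 0" using eq[of "length p + length q"] by (simp add: bead_def row_length_def)
  hence "row_length p i = row_length q i" for i using eq[of i] by (simp add: bead_def)
  thus ?thesis by (intro partition_eqI assms)
qed

lemma bead_set_bounds:
  assumes "is_partition p"
  shows "b \<in> bead_set p \<Longrightarrow> b \<le> int (row_length p 0)"
    and "b < - int (length p) \<Longrightarrow> b \<in> bead_set p"
proof -
  assume "b \<in> bead_set p"
  then obtain i where "b = bead p i" by (auto simp: bead_set_def)
  thus "b \<le> int (row_length p 0)"
    using row_length_antimono[OF assms, of 0 i] by (simp add: bead_def)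
next
  assume "b < - int (length p)"
  hence "b = bead p (nat (- b - 1))" by (simp add: bead_def row_length_def)
  thus "b \<in> bead_set p" by (simp add: bead_set_def)
qed

text \<open>
  The parts of the partition count, for each bead above the lowest gap, the gaps below it. The
  translation makes the fully occupied part end where it does for a partition with as many parts
  as there are beads above the lowest gap.
\<close>

lemma partition_of_bead_set:
  fixes B :: "int set"
  assumes ub: "\<And>b. b \<in> B \<Longrightarrow> b \<le> M" and lb: "\<And>b. b \<le> L \<Longrightarrow> b \<in> B"
  shows "\<exists>p c. is_partition p \<and> bead_set p = (\<lambda>b. b + c) ` B"
proof -
  have "L \<le> M" using ub[OF lb[of L]] by simp
  \<comment> \<open>\<open>N + 1\<close> is the lowest gap.\<close>
  define G where "G = {L<..M + 1} - B"
  have G: "finite G" "M + 1 \<in> G"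
    using \<open>L \<le> M\<close> ub[of "M + 1"] by (auto simp: G_def)
  define N where "N = Min G - 1"
  have "Min G \<in> G" using G by (intro Min_in) auto
  hence "N + 1 \<in> G" by (simp add: N_def)
  hence N1: "N + 1 \<notin> B" "L \<le> N" by (auto simp: G_def)
  have N: "b \<in> B" if "b \<le> N" for b
  proof (rule ccontr)
    assume "b \<notin> B"
    hence "L < b" using lb[of b] by force
    hence "b \<in> G" using \<open>b \<notin> B\<close> that \<open>N + 1 \<in> G\<close> by (auto simp: G_def)
    hence "N + 1 \<le> b" using Min_le[OF G(1)] by (simp add: N_def)
    thus False using that by simp
  qed
  define F where "F = B \<inter> {N<..}"
  have finF: "finite F" using ub by (intro finite_subset[of F "{N<..M}"]) (auto simp: F_def)
  define xs where "xs = rev (sorted_list_of_set F)"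
  have set_xs: "set xs = F" by (simp add: xs_def finF)
  have sw: "sorted_wrt (>) xs"
    by (simp add: xs_def sorted_wrt_rev)
  define s where "s = length xs"
  have xs_gt: "N + 1 < xs ! i" if "i < s" for i
  proof -
    have "xs ! i \<in> F" using that set_xs nth_mem[of i xs] by (auto simp: s_def)
    thus ?thesis using N1(1) by (cases "xs ! i = N + 1") (auto simp: F_def)
  qed
  have xs_step: "xs ! j + int (j - i) \<le> xs ! i" if "i \<le> j" "j < s" for i j
    using that
  proof (induction j rule: dec_induct)
    case base show ?case by simp
  next
    case (step j)
    have "xs ! Suc j < xs ! j"
      using sorted_wrt_nth_less[OF sw, of j "Suc j"] step by (auto simp: s_def)
    thus ?case using step by (simp add: Suc_diff_le)
  qed
  \<comment> \<open>The bead with index \<open>s\<close> is \<open>N\<close>, and it must be moved to \<open>- s - 1\<close>.\<close>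
  define c where "c = - (N + int s + 1)"
  define p where "p = map (\<lambda>i. nat (xs ! i + c + int i + 1)) [0..<s]"
  have pos: "0 < xs ! i + c + int i + 1" if "i < s" for i
    using xs_step[of i "s - 1"] xs_gt[of "s - 1"] that
    by (cases "i \<le> s - 1") (simp_all add: c_def of_nat_diff)
  have "is_partition p"
  proof -
    have "p ! j \<le> p ! i" if "i < j" "j < length p" for i j
      using xs_step[of i j] that by (auto simp: p_def nat_le_eq_zle of_nat_diff intro!: nat_mono)
    hence "sorted_wrt (\<ge>) p" by (simp add: sorted_wrt_iff_nth_less)
    moreover have "0 \<notin> set p" using pos by (force simp: p_def)
    ultimately show ?thesis by (simp add: is_partition_def)
  qed
  moreover have bead_lt: "bead p i = xs ! i + c" if "i < s" for i
    using pos[OF that] that by (simp add: bead_def row_length_def p_def)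
  have bead_ge: "bead p i = N + int s - int i + c" if "s \<le> i" for i
    using that by (simp add: bead_def row_length_def p_def c_def)
  have "bead_set p = (\<lambda>b. b + c) ` B"
  proof (intro equalityI subsetI)
    fix b assume "b \<in> bead_set p"
    then obtain i where i: "b = bead p i" by (auto simp: bead_set_def)
    show "b \<in> (\<lambda>b. b + c) ` B"
    proof (cases "i < s")
      case True
      hence "xs ! i \<in> F" using set_xs nth_mem[of i xs] by (auto simp: s_def)
      thus ?thesis using bead_lt[OF True] i by (auto simp: F_def)
    next
      case False
      thus ?thesis using bead_ge[of i] i N[of "N + int s - int i"] by auto
    qed
  next
    fix b assume "b \<in> (\<lambda>b. b + c) ` B"
    then obtain a where a: "a \<in> B" "b = a + c" by auto
    show "b \<in> bead_set p"
    proof (cases "a \<le> N")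
      case True
      hence "b = bead p (s + nat (N - a))" using bead_ge[of "s + nat (N - a)"] a by simp
      thus ?thesis by (simp add: bead_set_def)
    next
      case False
      hence "a \<in> set xs" using a set_xs by (simp add: F_def)
      then obtain i where "i < s" "a = xs ! i" by (metis in_set_conv_nth s_def)
      hence "b = bead p i" using bead_lt a by simp
      thus ?thesis by (simp add: bead_set_def)
    qed
  qed
  ultimately show ?thesis by blast
qed

lemma partition_of_row_lengths:
  assumes anti: "\<And>a b. a \<le> b \<Longrightarrow> h b \<le> h a" and zero: "h k = 0"
  shows "\<exists>q. is_partition q \<and> row_length q = h"
proof -
  define s where "s = (LEAST k. h k = 0)"
  have hs: "h s = 0" unfolding s_def by (rule LeastI, rule zero)
  have pos: "0 < h i" if "i < s" for i using that not_less_Least[of i "\<lambda>k. h k = 0"] by (simp add: s_def)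
  define q where "q = map h [0..<s]"
  have "sorted_wrt (\<ge>) q" using anti by (simp add: q_def sorted_wrt_iff_nth_less)
  moreover have "0 \<notin> set q" using pos by (force simp: q_def)
  moreover have "row_length q = h"
  proof
    fix i show "row_length q i = h i"
      using hs anti[of s i] by (cases "i < s") (auto simp: row_length_def q_def)
  qed
  ultimately show ?thesis by (auto simp: is_partition_def)
qed

text \<open>
  Deleting a box leaves a Young diagram exactly if nothing lies to its right or below it.
\<close>

lemma removable_box_iff:
  assumes p: "is_partition p"
  shows "x \<in> removable_boxes p \<longleftrightarrow>
    (\<exists>i. x = (Suc i, row_length p i) \<and> row_length p (Suc i) < row_length p i)"
proof
  assume "x \<in> removable_boxes p"
  then obtain q where x: "x \<in> diagram p" and q: "is_partition q" "diagram q = diagram p - {x}"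
    by (auto simp: removable_boxes_def)
  obtain a b where ab: "x = (Suc a, b)" "1 \<le> b" "b \<le> row_length p a"
    using x by (cases x; cases "fst x") (auto simp: mem_diagram_iff)
  have mem: "(Suc k, l) \<in> diagram q \<longleftrightarrow> 1 \<le> l \<and> l \<le> row_length p k \<and> (k, l) \<noteq> (a, b)" for k l
    using q(2) ab by (auto simp: mem_diagram_iff)
  have q_mem: "(Suc k, l) \<in> diagram q \<longleftrightarrow> 1 \<le> l \<and> l \<le> row_length q k" for k l
    by (auto simp: mem_diagram_iff)
  have qa: "row_length q a < b" using mem[of a b] q_mem[of a b] ab by auto
  have "b = row_length p a"
  proof (rule ccontr)
    assume "b \<noteq> row_length p a"
    thus False using qa mem[of a "row_length p a"] q_mem[of a "row_length p a"] ab by auto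
  qed
  moreover have "row_length p (Suc a) < b"
  proof (rule ccontr)
    assume "\<not> row_length p (Suc a) < b"
    hence "b \<le> row_length q (Suc a)" using mem[of "Suc a" b] q_mem[of "Suc a" b] ab by auto
    thus False using qa row_length_antimono[OF q(1), of a "Suc a"] by simp
  qed
  ultimately show "\<exists>i. x = (Suc i, row_length p i) \<and> row_length p (Suc i) < row_length p i"
    using ab by blast
next
  assume "\<exists>i. x = (Suc i, row_length p i) \<and> row_length p (Suc i) < row_length p i"
  then obtain i where x: "x = (Suc i, row_length p i)" and lt: "row_length p (Suc i) < row_length p i"
    by blast
  have xd: "x \<in> diagram p" using x lt by (simp add: mem_diagram_iff)
  define h where "h = (\<lambda>k. if k = i then row_length p i - 1 else row_length p k)"
  have h_anti: "h b \<le> h a" if "a \<le> b" for a b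
  proof -
    have "a = b \<or> a = i \<and> Suc i \<le> b \<or> a \<noteq> i" using that by linarith
    then consider "a = b" | "a = i" "Suc i \<le> b" | "a \<noteq> i" by blast
    thus ?thesis
    proof cases
      case 2
      thus ?thesis using row_length_antimono[OF p, of "Suc i" b] lt by (simp add: h_def)
    next
      case 3
      thus ?thesis using row_length_antimono[OF p that] by (cases "b = i") (simp_all add: h_def)
    qed simp
  qed
  have "h (length p) = 0" using lt by (simp add: h_def row_length_def)
  then obtain q where q: "is_partition q" "row_length q = h"
    using partition_of_row_lengths[of h] h_anti by blast
  have "diagram q = diagram p - {x}"
  proof (intro set_eqI)
    fix y show "y \<in> diagram q \<longleftrightarrow> y \<in> diagram p - {x}"
      using q(2) x lt by (cases y) (auto simp: mem_diagram_iff h_def)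
  qed
  thus "x \<in> removable_boxes p" using xd q(1) by (auto simp: removable_boxes_def)
qed

text \<open>
  The last box of row \<open>i + 1\<close> has content equal to the bead of that row, and it is
  removable exactly if the next lower integer is a gap.
\<close>

lemma card_removable_boxes_eq:
  assumes p: "is_partition p"
  shows "card {x \<in> removable_boxes p. residue n x = r}
       = card {b \<in> bead_set p. b - 1 \<notin> bead_set p \<and> b mod int n = r}"
proof -
  have prev: "bead p i - 1 \<notin> bead_set p \<longleftrightarrow> row_length p (Suc i) < row_length p i" for i
  proof
    assume "bead p i - 1 \<notin> bead_set p"
    hence "bead p (Suc i) \<noteq> bead p i - 1" unfolding bead_set_def by (metis rangeI)
    thus "row_length p (Suc i) < row_length p i"
      using row_length_antimono[OF p, of i "Suc i"] by (auto simp: bead_def)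
  next
    assume lt: "row_length p (Suc i) < row_length p i"
    show "bead p i - 1 \<notin> bead_set p"
    proof
      assume "bead p i - 1 \<in> bead_set p"
      then obtain k where k: "bead p k = bead p i - 1" by (auto simp: bead_set_def)
      have "i < k" using k bead_strict_antimono[OF p, of k i] by (cases i k rule: linorder_cases) auto
      hence "bead p k \<le> bead p (Suc i)"
        using bead_strict_antimono[OF p, of "Suc i" k] by (cases "k = Suc i") auto
      thus False using k lt by (simp add: bead_def)
    qed
  qed
  have res: "residue n (Suc i, row_length p i) = bead p i mod int n" for i
    by (simp add: residue_def bead_def algebra_simps)
  define I where "I = {i. row_length p (Suc i) < row_length p i \<and> bead p i mod int n = r}"
  have "{x \<in> removable_boxes p. residue n x = r} = (\<lambda>i. (Suc i, row_length p i)) ` I"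
    by (auto simp: removable_box_iff[OF p] I_def res)
  hence "card {x \<in> removable_boxes p. residue n x = r} = card I"
    by (simp add: card_image inj_on_def)
  moreover have "{b \<in> bead_set p. b - 1 \<notin> bead_set p \<and> b mod int n = r} = bead p ` I"
    using prev by (auto simp: bead_set_def I_def)
  moreover have "inj (bead p)"
    using bead_strict_antimono[OF p] by (metis injI less_irrefl linorder_neqE_nat)
  ultimately show ?thesis by (metis card_image inj_on_subset subset_UNIV)
qed

section \<open>Windows and their levels\<close>

definition window :: "('n::{finite,linorder} \<Rightarrow> int) \<Rightarrow> bool" where
  "window Y \<longleftrightarrow> (\<forall>i j. i < j \<longrightarrow> Y j < Y i) \<and> inj (\<lambda>i. Y i mod int CARD('n))"

definition gap_bounded :: "nat \<Rightarrow> ('n::{finite,linorder} \<Rightarrow> int) \<Rightarrow> bool" where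
  "gap_bounded m Y \<longleftrightarrow>
     (\<forall>i j. int CARD('n) dvd Y i - Y j - 1 \<longrightarrow> Y i - Y j \<le> int (m * CARD('n) + 1))"

definition level :: "('n::{finite,linorder} \<Rightarrow> int) \<Rightarrow> 'n \<Rightarrow> 'n \<Rightarrow> int" where
  "level Y i j = (Y i - Y j) div int CARD('n)"

lemma window_less_iff:
  assumes "window Y" shows "Y j < Y i \<longleftrightarrow> i < j"
  using assms unfolding window_def by (metis linorder_neqE order_less_asym order_less_irrefl)

lemma window_residue_inject:
  fixes Y :: "'n::{finite,linorder} \<Rightarrow> int"
  assumes "window Y" "int CARD('n) dvd Y i - Y j" shows "i = j"
  using assms unfolding window_def by (auto simp: mod_eq_dvd_iff dest: injD)

text \<open>The \<open>n\<close> values have different residues, so every residue occurs.\<close>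

lemma window_residue_exists:
  fixes Y :: "'n::{finite,linorder} \<Rightarrow> int"
  assumes "window Y" shows "\<exists>i. int CARD('n) dvd Y i - a"
proof -
  have "(\<lambda>i. Y i mod int CARD('n)) ` UNIV = {0..<int CARD('n)}"
    using assms by (intro card_subset_eq) (auto simp: window_def card_image)
  moreover have "a mod int CARD('n) \<in> {0..<int CARD('n)}" by simp
  ultimately have "a mod int CARD('n) \<in> (\<lambda>i. Y i mod int CARD('n)) ` UNIV" by (simp only:)
  then obtain i where "Y i mod int CARD('n) = a mod int CARD('n)" by auto
  thus ?thesis by (auto simp: mod_eq_dvd_iff)
qed

lemma window_shift:
  assumes "window Y" shows "window (\<lambda>i. Y i + c)"
  using assms unfolding window_def by (auto simp: inj_on_def mod_eq_dvd_iff)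

lemma gap_bounded_shift: "gap_bounded m (\<lambda>i. Y i + c) \<longleftrightarrow> gap_bounded m Y"
  by (simp add: gap_bounded_def)

lemma level_shift: "level (\<lambda>i. Y i + c) = level Y"
  by (simp add: level_def fun_eq_iff)

lemma level_nonneg:
  assumes "window Y" "i < j" shows "0 \<le> level Y i j"
  using assms unfolding level_def window_def by (intro pos_imp_zdiv_nonneg_iff[THEN iffD2]) (auto simp: less_imp_le)

lemma div_add_residues:
  fixes n :: int
  assumes "0 \<le> r" "0 \<le> s" "r + s < n" "n dvd a - r" "n dvd b - s"
  shows "(a + b) div n = a div n + b div n"
proof -
  have "a mod n = r mod n" "b mod n = s mod n" using assms(4,5) unfolding mod_eq_dvd_iff .
  hence "a mod n + b mod n < n" using assms by simp
  moreover have "0 \<le> a mod n + b mod n" using assms by (simp add: \<open>a mod n = r mod n\<close> \<open>b mod n = s mod n\<close>)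
  ultimately show ?thesis by (simp add: div_add1_eq[of a b n] div_pos_pos_trivial)
qed

text \<open>
  Follow the coordinates whose values have the residues of \<open>Y i\<close>, \<open>Y i - 1\<close>, \<open>Y i - 2\<close>, and so on until
  \<open>Y j\<close> is reached; there are fewer than \<open>n\<close> steps. Each step lowers the value by at most \<open>m n + 1\<close>,
  which is less than \<open>Y i - Y j\<close>, so the first value after the last one at or above \<open>Y i\<close> cannot
  jump over the interval between \<open>Y j\<close> and \<open>Y i\<close>. It yields \<open>l\<close>. The levels add up because the
  residue of \<open>Y l\<close> is met between those of \<open>Y i\<close> and \<open>Y j\<close>, so the two remainders sum to less than \<open>n\<close>.
\<close>

lemma level_split:
  fixes Y :: "'n::{finite,linorder} \<Rightarrow> int"
  assumes Y: "window Y" "gap_bounded m Y" and ij: "i < j" and big: "int (m * CARD('n) + 1) < Y i - Y j"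
  shows "\<exists>l. i < l \<and> l < j \<and> level Y i j = level Y i l + level Y l j"
proof -
  let ?n = "int CARD('n)"
  define d where "d = (Y i - Y j) mod ?n"
  have d: "0 \<le> d" "d < ?n" "?n dvd Y i - Y j - d" by (auto simp: d_def dvd_minus_mod)
  have "\<exists>u. ?n dvd Y u - (Y i - s)" for s by (rule window_residue_exists[OF Y(1)])
  then obtain c where c: "\<And>s. ?n dvd Y (c s) - (Y i - s)" by metis
  have c0: "c 0 = i" using c[of 0] by (intro window_residue_inject[OF Y(1)]) simp
  have cd: "c d = j"
  proof (rule window_residue_inject[OF Y(1)])
    have "Y (c d) - Y j = (Y (c d) - (Y i - d)) + (Y i - Y j - d)" by simp
    thus "?n dvd Y (c d) - Y j" using c[of d] d(3) by (metis dvd_add)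
  qed
  have ji: "Y j < Y i" using ij window_less_iff[OF Y(1)] by blast
  \<comment> \<open>The steps of the walk at which the value is not below \<open>Y i\<close>; the one after the last of them enters the interval.\<close>
  define S where "S = {s \<in> {0..d}. Y i \<le> Y (c s)}"
  have "finite S" by (rule finite_subset[of S "{0..d}"]) (auto simp: S_def)
  have "0 \<in> S" using d c0 by (simp add: S_def)
  define s where "s = Max S"
  have s: "s \<in> S" unfolding s_def using \<open>finite S\<close> \<open>0 \<in> S\<close> by (intro Max_in) auto
  have "s \<noteq> d" using s cd ji by (auto simp: S_def)
  hence "s < d" using s by (auto simp: S_def)
  have "s + 1 \<notin> S" using Max_ge[OF \<open>finite S\<close>, of "s + 1"] by (auto simp: s_def)
  hence below: "Y (c (s + 1)) < Y i" using \<open>s < d\<close> s by (auto simp: S_def)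
  define l where "l = c (s + 1)"
  have "Y (c s) - Y l - 1 = (Y (c s) - (Y i - s)) - (Y l - (Y i - (s + 1)))" by simp
  hence "?n dvd Y (c s) - Y l - 1" using c[of s] c[of "s + 1"] unfolding l_def by (metis dvd_diff)
  hence "Y (c s) - Y l \<le> int (m * CARD('n) + 1)" using Y(2) by (auto simp: gap_bounded_def)
  hence above: "Y j < Y l" using s big by (auto simp: S_def)
  have "?n dvd Y i - Y l - (s + 1)"
    using c[of "s + 1"] dvd_minus_iff[of ?n "Y l - (Y i - (s + 1))"] by (simp add: l_def algebra_simps)
  moreover have "?n dvd Y l - Y j - (d - (s + 1))"
  proof -
    have "Y l - Y j - (d - (s + 1)) = (Y l - (Y i - (s + 1))) + (Y i - Y j - d)" by simp
    thus ?thesis using c[of "s + 1"] d(3) unfolding l_def by (metis dvd_add)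
  qed
  ultimately have "((Y i - Y l) + (Y l - Y j)) div ?n = (Y i - Y l) div ?n + (Y l - Y j) div ?n"
    using s \<open>s < d\<close> d by (intro div_add_residues) (auto simp: S_def)
  hence "level Y i j = level Y i l + level Y l j" by (simp add: level_def)
  thus ?thesis using above below window_less_iff[OF Y(1)] by (auto simp: l_def)
qed

lemma level_gt_imp_diff:
  fixes Y :: "'n::{finite,linorder} \<Rightarrow> int"
  assumes "int m < level Y i j" "2 \<le> CARD('n)"
  shows "int (m * CARD('n) + 1) < Y i - Y j"
proof -
  have "int (m + 1) * int CARD('n) \<le> level Y i j * int CARD('n)"
    using assms by (intro mult_right_mono) auto
  also have "\<dots> \<le> Y i - Y j" unfolding level_def
    by (metis add.commute div_mod_decomp_int le_add_same_cancel2 mult.commute of_nat_0_le_iff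
        pos_mod_sign of_nat_0_less_iff zero_less_card_finite)
  finally show ?thesis using assms(2) by (simp add: algebra_simps)
qed

text \<open>
  By splitting, every level above \<open>m\<close> is a sum of smaller levels between closer
  coordinates, down to levels at most \<open>m\<close>, for which the bound is the hypothesis.
\<close>

lemma level_less_of_truncated:
  fixes Y :: "'n::{finite,linorder} \<Rightarrow> int" and x :: "'n \<Rightarrow> real"
  assumes Y: "window Y" "gap_bounded m Y" and n: "2 \<le> CARD('n)"
    and x: "\<And>i j. i < j \<Longrightarrow> of_int (min (int m) (level Y i j)) < x i - x j"
    and ij: "i < j"
  shows "of_int (level Y i j) < x i - x j"
  using ij
proof (induction "nat (Y i - Y j)" arbitrary: i j rule: less_induct)
  case less
  show ?case
  proof (cases "level Y i j \<le> int m")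
    case True
    thus ?thesis using x[OF less(2)] by simp
  next
    case False
    hence "int (m * CARD('n) + 1) < Y i - Y j" using level_gt_imp_diff[of m Y i j] n by auto
    then obtain l where l: "i < l" "l < j" "level Y i j = level Y i l + level Y l j"
      using level_split[OF Y less(2)] by blast
    have "Y l < Y i" "Y j < Y l" using l window_less_iff[OF Y(1)] by auto
    hence "of_int (level Y i l) < x i - x l" "of_int (level Y l j) < x l - x j"
      by (intro less(1); use l in auto)+
    thus ?thesis using l(3) by simp
  qed
qed

text \<open>
  Write \<open>Y o - Y i\<close> for the first coordinate \<open>o\<close> as \<open>n\<close>
  times a level plus a remainder \<open>r i\<close>. The levels between \<open>i\<close> and
  \<open>j\<close> show which of the remainders \<open>r i\<close> and \<open>r j\<close> is
  larger, and since the remainders are a permutation of \<open>0, \<dots>, n - 1\<close>, their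
  order determines them.
\<close>

lemma level_eq_imp_shift:
  fixes Y Z :: "'n::{finite,linorder} \<Rightarrow> int"
  assumes "window Y" "window Z" and eq: "\<And>i j. i < j \<Longrightarrow> level Y i j = level Z i j"
  shows "\<exists>c. \<forall>i. Z i = Y i + c"
proof -
  let ?n = "int CARD('n)"
  \<comment> \<open>The first coordinate serves as the origin of all differences.\<close>
  define o' where "o' = Min (UNIV :: 'n set)"
  have o': "o' = i \<or> o' < i" for i using Min_le[of UNIV i] by (auto simp: o'_def le_less)
  define r where "r = (\<lambda>(W::'n \<Rightarrow> int) i. (W o' - W i) mod ?n)"
  have r_range: "0 \<le> r W i" "r W i < ?n" for W i by (auto simp: r_def)
  have r_dec: "W o' - W i = ?n * level W o' i + r W i" for W i
    by (simp add: r_def level_def)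
  have rank: "r W i = int (card {l. r W l < r W i})" if "window W" for W i
  proof -
    have inj: "inj (r W)"
    proof (rule injI)
      fix a b assume "r W a = r W b"
      hence "?n dvd (W o' - W a) - (W o' - W b)" unfolding r_def by (simp only: mod_eq_dvd_iff)
      thus "a = b" using window_residue_inject[OF that, of b a] by simp
    qed
    have "range (r W) = {0..<?n}"
      using inj r_range by (intro card_subset_eq) (auto simp: card_image)
    have "r W ` {l. r W l < r W i} = range (r W) \<inter> {..<r W i}" by auto
    also have "\<dots> = {0..<r W i}" using \<open>range (r W) = _\<close> r_range(2)[of W i] by auto
    finally have "r W ` {l. r W l < r W i} = {0..<r W i}" .
    hence "card {l. r W l < r W i} = card {0..<r W i}" using inj by (metis card_image inj_on_subset subset_UNIV)
    thus ?thesis using r_range[of W i] by simp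
  qed
  have l0: "level Y o' i = level Z o' i" for i
    using o'[of i] eq[of o' i] by (auto simp: level_def)
  have lev: "level W i j = level W o' j - level W o' i + (r W j - r W i) div ?n" for W i j
  proof -
    have "W i - W j = (r W j - r W i) + ?n * (level W o' j - level W o' i)"
      using r_dec[of W i] r_dec[of W j] by (simp add: algebra_simps)
    thus ?thesis by (simp add: level_def)
  qed
  have sgn: "(r W j - r W i) div ?n = (if r W j < r W i then -1 else 0)" for W i j
  proof (cases "r W j < r W i")
    case True
    thus ?thesis
      using r_range[of W i] r_range[of W j] int_div_pos_eq[of "r W j - r W i" ?n "-1" "r W j - r W i + ?n"]
      by simp
  next
    case False
    thus ?thesis using r_range[of W i] r_range[of W j] by (simp add: div_pos_pos_trivial)
  qed
  have ord: "r Y j < r Y i \<longleftrightarrow> r Z j < r Z i" if "i < j" for i j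
    using eq[OF that] lev[of Y i j] lev[of Z i j] l0 sgn[of Y j i] sgn[of Z j i] by (auto split: if_splits)
  have ne: "r W i \<noteq> r W j" if "window W" "i \<noteq> j" for W i j
  proof
    assume "r W i = r W j"
    hence "?n dvd (W o' - W i) - (W o' - W j)" unfolding r_def by (simp only: mod_eq_dvd_iff)
    thus False using window_residue_inject[OF that(1), of j i] that(2) by simp
  qed
  have "r Y j < r Y i \<longleftrightarrow> r Z j < r Z i" for i j
    using ord[of i j] ord[of j i] ne[OF assms(1), of i j] ne[OF assms(2), of i j]
    by (metis linorder_less_linear order_less_asym)
  hence "r Y i = r Z i" for i using rank[OF assms(1), of i] rank[OF assms(2), of i] by simp
  hence "Z i = Y i + (Z o' - Y o')" for i using r_dec[of Y i] r_dec[of Z i] l0[of i] by simp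
  thus ?thesis by blast
qed

text \<open>
  Moving by one unit changes the quotient only when a multiple of \<open>n\<close> is entered
  from below or left downwards.
\<close>

lemma div_same_of_small_change:
  fixes a n e :: int
  assumes "0 < n" "\<bar>e\<bar> \<le> 1" "e = 1 \<Longrightarrow> \<not> n dvd a + 1" "e = -1 \<Longrightarrow> \<not> n dvd a"
  shows "(a + e) div n = a div n"
proof (rule int_div_pos_eq)
  show "a + e = n * (a div n) + (a mod n + e)" by simp
  have "a mod n \<noteq> 0" if "e = -1" using assms(4)[OF that] by (simp add: dvd_eq_mod_eq_0)
  moreover have "a mod n \<ge> 0" "a mod n < n" using assms(1) by auto
  moreover have "a mod n + 1 \<noteq> n" if "e = 1"
  proof
    assume "a mod n + 1 = n"
    hence "a + 1 = n * (a div n) + n" using mult_div_mod_eq[of n a] by linarith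
    thus False using assms(3)[OF that] by simp
  qed
  moreover have "e = -1 \<or> e = 0 \<or> e = 1" using assms(2) by linarith
  ultimately have "0 \<le> a mod n + e \<and> a mod n + e < n" by (elim disjE) simp_all
  thus "0 \<le> a mod n + e" "a mod n + e < n" by simp_all
qed

text \<open>
  The modification exchanges the residues of the coordinates \<open>i\<close> and
  \<open>j\<close>: it is the reflection in the hyperplane on which the difference of these two
  coordinates is \<open>(Y i - Y j - 1) / n\<close>. This is the only hyperplane between the two
  alcoves, and its height exceeds \<open>m\<close>.
\<close>

lemma descend_step:
  fixes Y :: "'n::{finite,linorder} \<Rightarrow> int"
  assumes n: "2 \<le> CARD('n)" and Y: "window Y"
    and dv: "int CARD('n) dvd Y i - Y j - 1" and big: "int (m * CARD('n) + 1) < Y i - Y j"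
  defines "Z \<equiv> Y(i := Y i - 1, j := Y j + 1)"
  shows "window Z" "\<And>a b. a < b \<Longrightarrow> min (int m) (level Z a b) = min (int m) (level Y a b)"
    "(\<Sum>a\<in>UNIV. (Z a)\<^sup>2) < (\<Sum>a\<in>UNIV. (Y a)\<^sup>2)"
proof -
  let ?n = "int CARD('n)"
  have n0: "0 < ?n" "2 \<le> ?n" using n by auto
  have "0 \<le> int (m * CARD('n) + 1)" by simp
  hence "Y j < Y i" using big by linarith
  hence ij: "i \<noteq> j" "Y j < Y i" "i < j" using window_less_iff[OF Y, of j i] by auto
  have res: "?n dvd Y a - Y b \<longleftrightarrow> a = b" for a b using window_residue_inject[OF Y] by auto
  have succ: "?n dvd Y a - Y b - 1 \<Longrightarrow> a = i \<longleftrightarrow> b = j" for a b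
  proof -
    assume d: "?n dvd Y a - Y b - 1"
    hence "?n dvd (Y a - Y b - 1) - (Y i - Y j - 1)" using dv by (rule dvd_diff)
    hence "?n dvd (Y a - Y i) - (Y b - Y j)" by (simp add: algebra_simps)
    thus "a = i \<longleftrightarrow> b = j" using res by (metis diff_self diff_zero dvd_minus_iff minus_diff_eq diff_0)
  qed
  have inj: "a = b" if "?n dvd Z a - Z b" for a b
  proof -
    have "Y i - 1 - (Y j + 1) = (Y i - Y j - 1) - 1" by simp
    moreover have "\<not> ?n dvd 1" using n0 by auto
    ultimately have 1: "\<not> ?n dvd Y i - 1 - (Y j + 1)" using dv by (metis dvd_diff_right_iff)
    have 2: "?n dvd Y i - 1 - Y b \<longleftrightarrow> b = j" for b
    proof -
      have "Y i - 1 - Y b = (Y i - Y j - 1) + (Y j - Y b)" by simp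
      thus ?thesis using dv res[of j b] by (metis dvd_add_right_iff)
    qed
    have 3: "?n dvd Y j + 1 - Y b \<longleftrightarrow> b = i" for b
    proof -
      have "Y j + 1 - Y b = (Y i - Y b) - (Y i - Y j - 1)" by simp
      thus ?thesis using dv res[of i b] by (metis dvd_diff_left_iff)
    qed
    have sym: "?n dvd x - y \<longleftrightarrow> ?n dvd y - x" for x y by (metis dvd_minus_iff minus_diff_eq)
    show ?thesis using that 1 2[of b] 3[of b] 2[of a] 3[of a] res[of a b] ij(1)
        sym[of "Y a" "Y i - 1"] sym[of "Y a" "Y j + 1"] sym[of "Y j + 1" "Y i - 1"]
      by (auto simp: Z_def split: if_splits)
  qed
  have lev: "level Z a b = level Y a b" if "a \<noteq> b" "(a, b) \<noteq> (i, j)" "(a, b) \<noteq> (j, i)" for a b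
  proof -
    define e where "e = (Z a - Y a) - (Z b - Y b)"
    have "(Y a - Y b + e) div ?n = (Y a - Y b) div ?n"
    proof (rule div_same_of_small_change[OF n0(1)])
      show "\<bar>e\<bar> \<le> 1" using that ij by (auto simp: e_def Z_def)
      show "\<not> ?n dvd Y a - Y b" using that res by simp
      assume "e = 1"
      hence "a = j \<or> b = i" using that ij by (auto simp: e_def Z_def split: if_splits)
      moreover have "?n dvd Y b - Y a - 1 \<Longrightarrow> b = i \<longleftrightarrow> a = j" by (rule succ)
      moreover have "?n dvd Y a - Y b + 1 \<longleftrightarrow> ?n dvd Y b - Y a - 1"
        using dvd_minus_iff[of ?n "Y a - Y b + 1"] by (simp add: algebra_simps)
      ultimately show "\<not> ?n dvd Y a - Y b + 1" using that by auto
    qed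
    thus ?thesis by (simp add: level_def e_def algebra_simps)
  qed
  obtain q where q: "Y i - Y j - 1 = ?n * q" using dv by auto
  have "?n * int m < ?n * q" using big q by (simp add: algebra_simps)
  hence qm: "int m < q" using n0 by simp
  have "level Y i j = q"
    using q n0 by (simp add: level_def, intro int_div_pos_eq[of _ _ _ 1]) auto
  moreover have "level Z i j = q - 1"
    using q n0 ij by (simp add: level_def Z_def, intro int_div_pos_eq[of _ _ _ "?n - 1"]) (auto simp: algebra_simps)
  ultimately have lij: "min (int m) (level Z i j) = min (int m) (level Y i j)" "0 \<le> level Z i j"
    using qm by auto
  show "min (int m) (level Z a b) = min (int m) (level Y a b)" if "a < b" for a b
  proof (cases "(a, b) = (i, j)")
    case False
    moreover have "a \<noteq> b" "(a, b) \<noteq> (j, i)" using that ij(3) by (auto dest: order_less_asym)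
    ultimately show ?thesis using lev by metis
  qed (use lij in simp)
  have "0 \<le> level Z a b" if "a < b" for a b
  proof (cases "(a, b) = (i, j)")
    case False
    moreover have "a \<noteq> b" "(a, b) \<noteq> (j, i)" using that ij(3) by (auto dest: order_less_asym)
    ultimately show ?thesis using lev level_nonneg[OF Y that] by metis
  qed (use lij in simp)
  hence "Z b \<le> Z a" if "a < b" for a b
    using that n0 by (simp add: level_def pos_imp_zdiv_nonneg_iff)
  moreover have "Z b \<noteq> Z a" if "a < b" for a b using inj[of b a] that by auto
  ultimately show "window Z"
    using inj by (auto simp: window_def inj_on_def mod_eq_dvd_iff le_less)
  have "(\<Sum>a\<in>UNIV. (W a)\<^sup>2) = (W i)\<^sup>2 + ((W j)\<^sup>2 + (\<Sum>a\<in>UNIV - {i} - {j}. (W a)\<^sup>2))" for W :: "'n \<Rightarrow> int"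
    using ij by (simp add: sum.remove[of UNIV i] sum.remove[of "UNIV - {i}" j])
  moreover have "(\<Sum>a\<in>UNIV - {i} - {j}. (Z a)\<^sup>2) = (\<Sum>a\<in>UNIV - {i} - {j}. (Y a)\<^sup>2)"
    by (intro sum.cong) (auto simp: Z_def)
  moreover have "(Z i)\<^sup>2 + (Z j)\<^sup>2 < (Y i)\<^sup>2 + (Y j)\<^sup>2"
  proof -
    have "1 * ?n \<le> q * ?n" using qm by (intro mult_right_mono) auto
    hence "1 < Y i - Y j" using q n0 by (simp add: algebra_simps)
    thus ?thesis using ij by (simp add: Z_def power2_eq_square algebra_simps)
  qed
  ultimately show "(\<Sum>a\<in>UNIV. (Z a)\<^sup>2) < (\<Sum>a\<in>UNIV. (Y a)\<^sup>2)" by simp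
qed

lemma gap_bounded_representative:
  fixes Y :: "'n::{finite,linorder} \<Rightarrow> int"
  assumes "2 \<le> CARD('n)" "window Y"
  shows "\<exists>Z. window Z \<and> gap_bounded m Z \<and>
           (\<forall>a b. a < b \<longrightarrow> min (int m) (level Z a b) = min (int m) (level Y a b))"
  using assms(2)
proof (induction "nat (\<Sum>a\<in>UNIV. (Y a)\<^sup>2)" arbitrary: Y rule: less_induct)
  case less
  show ?case
  proof (cases "gap_bounded m Y")
    case True
    thus ?thesis using less(2) by blast
  next
    case False
    then obtain i j where ij: "int CARD('n) dvd Y i - Y j - 1" "int (m * CARD('n) + 1) < Y i - Y j"
      unfolding gap_bounded_def by (metis not_le)
    define Z where "Z = Y(i := Y i - 1, j := Y j + 1)"
    note step = descend_step[OF assms(1) less(2) ij, folded Z_def]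
    have "0 \<le> (\<Sum>a\<in>UNIV. (Z a)\<^sup>2)" by (simp add: sum_nonneg)
    hence "nat (\<Sum>a\<in>UNIV. (Z a)\<^sup>2) < nat (\<Sum>a\<in>UNIV. (Y a)\<^sup>2)" using step(3) by simp
    from less(1)[OF this step(1)] obtain W where W: "window W" "gap_bounded m W"
        "\<forall>a b. a < b \<longrightarrow> min (int m) (level W a b) = min (int m) (level Z a b)" by blast
    have "\<forall>a b. a < b \<longrightarrow> min (int m) (level W a b) = min (int m) (level Y a b)"
      using W(3) step(2) by simp
    thus ?thesis using W(1,2) by blast
  qed
qed

text \<open>
  Replace the fractional part of each coordinate by its rank among the fractional parts, with
  ties broken by the order of the coordinates. A tie means that a difference is an integer, which
  by hypothesis exceeds \<open>m\<close>; then the floor may drop by one, but not below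
  \<open>m\<close>.
\<close>

lemma window_of_point:
  fixes x :: "'n::{finite,linorder} \<Rightarrow> real"
  assumes dec: "\<And>i j. i < j \<Longrightarrow> x j < x i"
    and off: "\<And>i j k. i < j \<Longrightarrow> 0 \<le> k \<Longrightarrow> k \<le> int m \<Longrightarrow> x i - x j \<noteq> of_int k"
  shows "\<exists>Y. window Y \<and> (\<forall>i j. i < j \<longrightarrow> min (int m) (level Y i j) = min (int m) \<lfloor>x i - x j\<rfloor>)"
proof -
  let ?n = "int CARD('n)"
  define P where "P = (\<lambda>l i. frac (x l) < frac (x i) \<or> frac (x l) = frac (x i) \<and> l < i)"
  define r where "r = (\<lambda>i. card {l. P l i})"
  have P: "P a b \<or> P b a" if "a \<noteq> b" for a b using that by (auto simp: P_def)
  have r_less: "r a < r b" if "P a b" for a b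
    unfolding r_def using that by (intro psubset_card_mono) (auto simp: P_def)
  have r_iff: "r a < r b \<longleftrightarrow> P a b" if "a \<noteq> b" for a b
    using r_less[of a b] r_less[of b a] P[OF that] by auto
  have r_lt: "r i < CARD('n)" for i
  proof -
    have "r i < card (UNIV :: 'n set)"
      unfolding r_def by (intro psubset_card_mono) (auto simp: P_def)
    thus ?thesis .
  qed
  define Y where "Y = (\<lambda>i. ?n * \<lfloor>x i\<rfloor> + int (r i))"
  have lev: "level Y i j = \<lfloor>x i\<rfloor> - \<lfloor>x j\<rfloor> + (if P i j then -1 else 0)" if "i \<noteq> j" for i j
  proof -
    have "Y i - Y j = ?n * (\<lfloor>x i\<rfloor> - \<lfloor>x j\<rfloor>) + (int (r i) - int (r j))"
      by (simp add: Y_def algebra_simps)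
    thus ?thesis unfolding level_def
      using r_iff[OF that] r_lt[of i] r_lt[of j]
      by (intro int_div_pos_eq[of _ _ _ "int (r i) - int (r j) + (if P i j then ?n else 0)"])
         (auto simp: algebra_simps)
  qed
  have fl: "\<lfloor>x i - x j\<rfloor> = \<lfloor>x i\<rfloor> - \<lfloor>x j\<rfloor> + (if frac (x i) < frac (x j) then -1 else 0)" for i j
  proof -
    have "of_int \<lfloor>x i\<rfloor> = x i - frac (x i)" "of_int \<lfloor>x j\<rfloor> = x j - frac (x j)"
      by (simp_all add: frac_def)
    note b = this frac_ge_0[of "x i"] frac_ge_0[of "x j"] frac_lt_1[of "x i"] frac_lt_1[of "x j"]
    show ?thesis
    proof (cases "frac (x i) < frac (x j)")
      case True
      hence "\<lfloor>x i - x j\<rfloor> = \<lfloor>x i\<rfloor> - \<lfloor>x j\<rfloor> - 1"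
        using b by (intro floor_unique; unfold of_int_diff of_int_1; linarith)
      thus ?thesis using True by simp
    next
      case False
      hence "\<lfloor>x i - x j\<rfloor> = \<lfloor>x i\<rfloor> - \<lfloor>x j\<rfloor>"
        using b by (intro floor_unique; unfold of_int_diff of_int_1; linarith)
      thus ?thesis using False by simp
    qed
  qed
  have mods: "Y i mod ?n = int (r i)" for i using r_lt[of i] by (simp add: Y_def)
  have inj: "inj (\<lambda>i. Y i mod ?n)"
  proof (rule injI)
    fix a b assume "Y a mod ?n = Y b mod ?n"
    hence "r a = r b" by (simp add: mods)
    thus "a = b" using r_less[of a b] r_less[of b a] P[of a b] by (cases "a = b") auto
  qed
  have "min (int m) (level Y i j) = min (int m) \<lfloor>x i - x j\<rfloor>" if "i < j" for i j
  proof (cases "frac (x i) = frac (x j)")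
    case False
    thus ?thesis using that lev[of i j] fl[of i j] by (auto simp: P_def)
  next
    case True
    hence eq: "x i - x j = of_int (\<lfloor>x i\<rfloor> - \<lfloor>x j\<rfloor>)" by (simp add: frac_def)
    have "0 < \<lfloor>x i\<rfloor> - \<lfloor>x j\<rfloor>" using dec[OF that] eq by simp
    hence "int m < \<lfloor>x i\<rfloor> - \<lfloor>x j\<rfloor>" using off[OF that, of "\<lfloor>x i\<rfloor> - \<lfloor>x j\<rfloor>"] eq by force
    thus ?thesis using that lev[of i j] fl[of i j] by auto
  qed
  moreover have "Y j < Y i" if "i < j" for i j
  proof -
    have "0 \<le> level Y i j"
    proof (cases "frac (x i) = frac (x j)")
      case False
      moreover have "0 \<le> \<lfloor>x i - x j\<rfloor>" using dec[OF that] by simp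
      ultimately show ?thesis using that lev[of i j] fl[of i j] by (auto simp: P_def)
    next
      case True
      hence "x i - x j = of_int (\<lfloor>x i\<rfloor> - \<lfloor>x j\<rfloor>)" by (simp add: frac_def)
      hence "0 < \<lfloor>x i\<rfloor> - \<lfloor>x j\<rfloor>" using dec[OF that] by simp
      thus ?thesis using that lev[of i j] by auto
    qed
    hence "Y j \<le> Y i" by (simp add: level_def pos_imp_zdiv_nonneg_iff)
    moreover have "Y j \<noteq> Y i" using injD[OF inj, of j i] that by auto
    ultimately show ?thesis by simp
  qed
  ultimately show ?thesis using inj by (intro exI[of _ Y]) (auto simp: window_def)
qed

section \<open>Windows of cores\<close>

text \<open>
  The set of which \<open>Y\<close> lists the largest element in each residue class.
\<close>

definition beads :: "('n::{finite,linorder} \<Rightarrow> int) \<Rightarrow> int set" where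
  "beads Y = {b. \<exists>i. b \<le> Y i \<and> int CARD('n) dvd Y i - b}"

lemma mem_beads_iff:
  fixes Y :: "'n::{finite,linorder} \<Rightarrow> int"
  assumes "window Y" "int CARD('n) dvd Y i - b"
  shows "b \<in> beads Y \<longleftrightarrow> b \<le> Y i"
proof
  assume "b \<in> beads Y"
  then obtain j where j: "b \<le> Y j" "int CARD('n) dvd Y j - b" by (auto simp: beads_def)
  have "int CARD('n) dvd (Y i - b) - (Y j - b)" using assms(2) j(2) by (rule dvd_diff)
  hence "i = j" using window_residue_inject[OF assms(1), of i j] by simp
  thus "b \<le> Y i" using j by simp
qed (use assms in \<open>auto simp: beads_def\<close>)

lemma beads_closed:
  fixes Y :: "'n::{finite,linorder} \<Rightarrow> int"
  assumes "b \<in> beads Y" shows "b - int CARD('n) \<in> beads Y"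
proof -
  obtain i where "b \<le> Y i" "int CARD('n) dvd Y i - b" using assms by (auto simp: beads_def)
  moreover have "Y i - (b - int CARD('n)) = (Y i - b) + int CARD('n)" by simp
  ultimately have "b - int CARD('n) \<le> Y i" "int CARD('n) dvd Y i - (b - int CARD('n))"
    by (simp, metis dvd_add dvd_refl)
  thus ?thesis unfolding beads_def by blast
qed

lemma beads_shift:
  fixes Y :: "'n::{finite,linorder} \<Rightarrow> int"
  shows "beads (\<lambda>i. Y i + c) = (\<lambda>b. b + c) ` beads Y"
proof (intro equalityI subsetI)
  fix b assume "b \<in> beads (\<lambda>i. Y i + c)"
  then obtain i where "b \<le> Y i + c" "int CARD('n) dvd Y i + c - b" by (auto simp: beads_def)
  hence "b - c \<in> beads Y" by (auto simp: beads_def algebra_simps)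
  thus "b \<in> (\<lambda>b. b + c) ` beads Y" by force
next
  fix b assume "b \<in> (\<lambda>b. b + c) ` beads Y"
  thus "b \<in> beads (\<lambda>i. Y i + c)" by (auto simp: beads_def)
qed

text \<open>
  The values of a window are the beads that are largest in their residue class, so they can be
  read off the bead set.
\<close>

lemma range_window_eq:
  fixes Y :: "'n::{finite,linorder} \<Rightarrow> int"
  assumes "window Y"
  shows "range Y = {b \<in> beads Y. b + int CARD('n) \<notin> beads Y}"
proof (intro equalityI subsetI)
  fix b assume "b \<in> range Y"
  then obtain i where "b = Y i" by auto
  thus "b \<in> {b \<in> beads Y. b + int CARD('n) \<notin> beads Y}"
    using mem_beads_iff[OF assms, of i "Y i"] mem_beads_iff[OF assms, of i "Y i + int CARD('n)"] by simp
next
  fix b assume b: "b \<in> {b \<in> beads Y. b + int CARD('n) \<notin> beads Y}"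
  obtain i where i: "int CARD('n) dvd Y i - b" using window_residue_exists[OF assms] by blast
  hence i': "int CARD('n) dvd Y i - (b + int CARD('n))"
    by (metis diff_diff_eq dvd_diff dvd_refl)
  have le: "b \<le> Y i" "Y i < b + int CARD('n)"
    using b mem_beads_iff[OF assms i] mem_beads_iff[OF assms i'] by auto
  have "Y i - b = 0" using le i zdvd_not_zless[of "Y i - b" "int CARD('n)"] by force
  thus "b \<in> range Y" by (metis eq_iff_diff_eq_0 rangeI)
qed

lemma beads_inject:
  fixes Y Z :: "'n::{finite,linorder} \<Rightarrow> int"
  assumes "window Y" "window Z" "beads Y = beads Z"
  shows "Y = Z"
proof (rule ccontr)
  assume "Y \<noteq> Z"
  hence ne: "{i. Y i \<noteq> Z i} \<noteq> {}" by (auto simp: fun_eq_iff)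
  define i where "i = Min {i. Y i \<noteq> Z i}"
  have i: "Y i \<noteq> Z i" using Min_in[OF _ ne] by (simp add: i_def)
  have before: "Y j = Z j" if "j < i" for j
    using that Min_le[of "{i. Y i \<noteq> Z i}" j] by (auto simp: i_def not_le[symmetric])
  have ran: "range Y = range Z" using range_window_eq assms by metis
  obtain a where a: "Y i = Z a" using ran by (metis rangeE rangeI)
  obtain b where b: "Z i = Y b" using ran by (metis rangeE rangeI)
  have "\<not> a < i" using before[of a] a window_less_iff[OF assms(1), of i a] by auto
  hence "i < a" using a i by (cases "a = i") auto
  hence 1: "Y i < Z i" using a window_less_iff[OF assms(2), of a i] by simp
  have "\<not> b < i" using before[of b] b window_less_iff[OF assms(2), of i b] by auto
  hence "i < b" using b i by (cases "b = i") auto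
  hence 2: "Z i < Y i" using b window_less_iff[OF assms(1), of b i] by simp
  show False using 1 2 by simp
qed

lemma decreasing_enumeration:
  fixes T :: "int set"
  assumes "card T = CARD('n::{finite,linorder})"
  shows "\<exists>Y :: 'n \<Rightarrow> int. (\<forall>i j. i < j \<longrightarrow> Y j < Y i) \<and> range Y = T"
proof -
  have fin: "finite T" using assms by (intro card_ge_0_finite) simp
  define xs where "xs = rev (sorted_list_of_set T)"
  have sw: "sorted_wrt (>) xs" by (simp add: xs_def sorted_wrt_rev)
  have xs: "set xs = T" "length xs = CARD('n)" using fin assms by (simp_all add: xs_def)
  define pos where "pos = (\<lambda>i :: 'n. card {..<i})"
  have pos_lt: "pos i < length xs" for i
    unfolding pos_def xs(2) by (intro psubset_card_mono) auto
  have pos_less: "pos i < pos j" if "i < j" for i j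
    unfolding pos_def using that by (intro psubset_card_mono) auto
  define Y where "Y = (\<lambda>i. xs ! pos i)"
  have dec: "Y j < Y i" if "i < j" for i j
    unfolding Y_def using sorted_wrt_nth_less[OF sw pos_less[OF that] pos_lt] by simp
  have "inj Y"
  proof (rule injI)
    fix a b assume "Y a = Y b"
    thus "a = b" using dec[of a b] dec[of b a] by (cases a b rule: linorder_cases) auto
  qed
  hence "card (range Y) = card T" using assms by (simp add: card_image)
  moreover have "range Y \<subseteq> T" using pos_lt nth_mem xs(1) by (auto simp: Y_def)
  ultimately have "range Y = T" using fin by (metis card_subset_eq)
  thus ?thesis using dec by blast
qed

text \<open>
  The largest beads of the residue classes are exactly the beads \<open>b\<close> for which
  \<open>b + n\<close> is a gap. There is one for each class, and listing them in decreasing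
  order gives the window.
\<close>

lemma window_of_bead_set:
  fixes B :: "int set"
  assumes ub: "\<And>b. b \<in> B \<Longrightarrow> b \<le> M" and lb: "\<And>b. b \<le> L \<Longrightarrow> b \<in> B"
    and cl: "\<forall>b\<in>B. b - int CARD('n::{finite,linorder}) \<in> B"
  shows "\<exists>Y :: 'n \<Rightarrow> int. window Y \<and> beads Y = B"
proof -
  let ?n = "int CARD('n)"
  note down = closed_under_multiples[OF cl _ _ _ zero_less_card_finite]
  define T where "T = {b \<in> B. b + ?n \<notin> B}"
  have above: "\<exists>t\<in>T. b \<le> t \<and> ?n dvd t - b" if "b \<in> B" for b
  proof -
    define C where "C = {c \<in> B. b \<le> c \<and> ?n dvd c - b}"
    have finC: "finite C" using ub by (intro finite_subset[of C "{b..M}"]) (auto simp: C_def)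
    have "b \<in> C" using that by (simp add: C_def)
    hence C: "Max C \<in> C" using finC by (intro Max_in) auto
    have "Max C + ?n \<notin> B"
    proof
      assume B: "Max C + ?n \<in> B"
      have "Max C + ?n - b = (Max C - b) + ?n" by (rule diff_add_eq[symmetric])
      moreover have "?n dvd Max C - b" using C unfolding C_def by blast
      ultimately have "?n dvd Max C + ?n - b" by (metis dvd_add dvd_refl)
      hence "Max C + ?n \<in> C" using B C by (simp add: C_def)
      thus False using Max_ge[OF finC, of "Max C + ?n"] by simp
    qed
    thus ?thesis using C by (intro bexI[of _ "Max C"]) (auto simp: C_def T_def)
  qed
  have uniq: "s = t" if "s \<in> T" "t \<in> T" "?n dvd s - t" for s t
  proof -
    have *: "\<not> s < t" if "s \<in> T" "t \<in> T" "?n dvd t - s" for s t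
    proof
      assume "s < t"
      hence "?n \<le> t - s" using that(3) by (intro zdvd_imp_le) auto
      moreover have "?n dvd t - (s + ?n)" using that(3) by (metis diff_diff_eq dvd_diff dvd_refl)
      moreover have "t \<in> B" using that(2) by (simp add: T_def)
      ultimately have "s + ?n \<in> B" using down[of t "s + ?n"] by simp
      thus False using that(1) by (simp add: T_def)
    qed
    have "?n dvd t - s" using that(3) by (metis dvd_minus_iff minus_diff_eq)
    thus ?thesis using *[of s t] *[of t s] that by auto
  qed
  have "(\<lambda>t. t mod ?n) ` T = {0..<?n}"
  proof (intro equalityI subsetI)
    fix r assume "r \<in> {0..<?n}"
    hence r: "0 \<le> r" "r < ?n" by auto
    have "L - (L - r) mod ?n \<in> B" by (intro lb) simp
    then obtain t where t: "t \<in> T" "?n dvd t - (L - (L - r) mod ?n)" using above by blast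
    have "?n dvd (L - r) - (L - r) mod ?n" by (simp add: dvd_minus_mod)
    hence "?n dvd (t - (L - (L - r) mod ?n)) + ((L - r) - (L - r) mod ?n)"
      using t(2) by (rule dvd_add[rotated])
    hence "?n dvd t - r" by (simp add: algebra_simps)
    hence "t mod ?n = r" using r by (metis mod_eq_dvd_iff mod_pos_pos_trivial)
    thus "r \<in> (\<lambda>t. t mod ?n) ` T" using t(1) by blast
  qed auto
  moreover have "inj_on (\<lambda>t. t mod ?n) T"
    using uniq by (intro inj_onI) (simp add: mod_eq_dvd_iff)
  ultimately have "card T = card {0..<?n}" by (metis card_image)
  hence "card T = CARD('n)" by simp
  then obtain Y :: "'n \<Rightarrow> int" where Y: "\<forall>i j. i < j \<longrightarrow> Y j < Y i" "range Y = T"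
    using decreasing_enumeration by blast
  have YT: "Y i \<in> T" for i using Y(2) by auto
  have "inj (\<lambda>i. Y i mod ?n)"
  proof (rule injI)
    fix a b assume "Y a mod ?n = Y b mod ?n"
    hence "Y a = Y b" using uniq YT by (simp add: mod_eq_dvd_iff)
    thus "a = b" using Y(1) by (metis less_irrefl linorder_neqE)
  qed
  hence "window Y" using Y(1) by (simp add: window_def)
  moreover have "beads Y = B"
  proof (intro equalityI subsetI)
    fix b assume "b \<in> beads Y"
    then obtain i where "b \<le> Y i" "?n dvd Y i - b" by (auto simp: beads_def)
    moreover have "Y i \<in> B" using YT[of i] by (simp add: T_def)
    ultimately show "b \<in> B" using down[of "Y i" b] by simp
  next
    fix b assume "b \<in> B"
    then obtain t where "t \<in> T" "b \<le> t" "?n dvd t - b" using above by blast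
    thus "b \<in> beads Y" using Y(2) by (auto simp: beads_def)
  qed
  ultimately show ?thesis by blast
qed

text \<open>
  It suffices to subtract from the largest bead \<open>Y i\<close> of each class. The result
  \<open>Y i - m n - 1\<close> lies in the class below that of \<open>Y i\<close>, whose largest
  bead is \<open>Y j\<close>.
\<close>

lemma beads_closed_iff_gap_bounded:
  fixes Y :: "'n::{finite,linorder} \<Rightarrow> int"
  assumes "window Y"
  shows "(\<forall>b\<in>beads Y. b - int (m * CARD('n) + 1) \<in> beads Y) \<longleftrightarrow> gap_bounded m Y"
proof
  let ?n = "int CARD('n)" and ?t = "int (m * CARD('n) + 1)"
  assume cl: "\<forall>b\<in>beads Y. b - ?t \<in> beads Y"
  show "gap_bounded m Y" unfolding gap_bounded_def
  proof (intro allI impI)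
    fix i j assume d: "?n dvd Y i - Y j - 1"
    have "Y i \<in> beads Y" by (auto simp: beads_def)
    hence "Y i - ?t \<in> beads Y" using cl by blast
    moreover have "?n dvd Y j - (Y i - ?t)"
    proof -
      have "Y j - (Y i - ?t) = ?n * int m - (Y i - Y j - 1)" by simp
      thus ?thesis using d by (metis dvd_diff dvd_triv_left)
    qed
    ultimately show "Y i - Y j \<le> ?t" using mem_beads_iff[OF assms] by fastforce
  qed
next
  let ?n = "int CARD('n)" and ?t = "int (m * CARD('n) + 1)"
  assume gb: "gap_bounded m Y"
  show "\<forall>b\<in>beads Y. b - ?t \<in> beads Y"
  proof
    fix b assume "b \<in> beads Y"
    then obtain i where i: "b \<le> Y i" "?n dvd Y i - b" by (auto simp: beads_def)
    obtain j where j: "?n dvd Y j - (Y i - 1)" using window_residue_exists[OF assms] by blast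
    hence "?n dvd Y i - Y j - 1" by (metis diff_diff_eq2 diff_diff_add diff_add_eq dvd_minus_iff minus_diff_eq add.commute)
    hence "Y i - Y j \<le> ?t" using gb by (auto simp: gap_bounded_def)
    moreover have "?n dvd Y j - (b - ?t)"
    proof -
      have "Y j - (b - ?t) = (Y j - (Y i - 1)) + ((Y i - b) + ?n * int m)" by simp
      thus ?thesis using i j by (metis dvd_add dvd_triv_left)
    qed
    ultimately show "b - ?t \<in> beads Y" using i mem_beads_iff[OF assms, of j "b - ?t"] by auto
  qed
qed

lemma window_of_core:
  assumes "is_core CARD('n::{finite,linorder}) p"
  shows "\<exists>Y :: 'n \<Rightarrow> int. window Y \<and> beads Y = bead_set p"
proof -
  have p: "is_partition p" and cl: "\<forall>b\<in>bead_set p. b - int CARD('n) \<in> bead_set p"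
    using assms by (auto simp: is_core_iff_closed)
  show ?thesis
    by (rule window_of_bead_set[OF bead_set_bounds(1)[OF p] bead_set_bounds(2)[OF p, OF zle_diff1_eq[THEN iffD1]] cl])
qed

lemma core_of_window:
  fixes Y :: "'n::{finite,linorder} \<Rightarrow> int"
  assumes "window Y"
  shows "\<exists>p c. is_core CARD('n) p \<and> bead_set p = beads (\<lambda>i. Y i + c)"
proof -
  let ?n = "int CARD('n)"
  have "\<exists>p c. is_partition p \<and> bead_set p = (\<lambda>b. b + c) ` beads Y"
  proof (rule partition_of_bead_set)
    fix b assume "b \<in> beads Y"
    then obtain i where "b \<le> Y i" by (auto simp: beads_def)
    also have "Y i \<le> Max (range Y)" by simp
    finally show "b \<le> Max (range Y)" .
  next
    fix b assume b: "b \<le> Min (range Y)"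
    obtain i where i: "?n dvd Y i - b" using window_residue_exists[OF assms] by blast
    have "Min (range Y) \<le> Y i" by simp
    thus "b \<in> beads Y" using i b by (auto simp: beads_def intro: order_trans)
  qed
  then obtain p c where pc: "is_partition p" "bead_set p = beads (\<lambda>i. Y i + c)"
    by (auto simp: beads_shift)
  have "is_core CARD('n) p"
    using pc beads_closed[of _ "\<lambda>i. Y i + c"] by (simp add: is_core_iff_closed)
  thus ?thesis using pc by blast
qed

text \<open>
  The beads below \<open>Y u\<close> in its class are consecutive, and the predecessor of such a bead is a gap
  as long as it lies above \<open>Y v\<close>; so the beads counted are \<open>Y u, Y u - n, \<dots>\<close> down to \<open>Y v + 1\<close>,
  exclusively.
\<close>

lemma card_removable_beads:
  fixes Y :: "'n::{finite,linorder} \<Rightarrow> int"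
  assumes Y: "window Y" and d: "int CARD('n) dvd Y u - Y v - 1"
  shows "card {b \<in> beads Y. b - 1 \<notin> beads Y \<and> b mod int CARD('n) = Y u mod int CARD('n)}
       = nat ((Y u - Y v - 1) div int CARD('n))"
proof -
  let ?n = "int CARD('n)"
  have n0: "0 < ?n" by simp
  obtain q where q: "Y u - Y v - 1 = ?n * q" using d by auto
  have mem: "b \<in> beads Y \<longleftrightarrow> b \<le> Y u" "b - 1 \<in> beads Y \<longleftrightarrow> b - 1 \<le> Y v"
    if "?n dvd Y u - b" for b
  proof -
    show "b \<in> beads Y \<longleftrightarrow> b \<le> Y u" by (rule mem_beads_iff[OF Y that])
    have "Y v - (b - 1) = (Y u - b) - (Y u - Y v - 1)" by simp
    hence "?n dvd Y v - (b - 1)" using that d by (metis dvd_diff)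
    thus "b - 1 \<in> beads Y \<longleftrightarrow> b - 1 \<le> Y v" by (rule mem_beads_iff[OF Y])
  qed
  have "{b \<in> beads Y. b - 1 \<notin> beads Y \<and> b mod ?n = Y u mod ?n} = (\<lambda>a. Y u - ?n * a) ` {0..<q}"
  proof (intro equalityI subsetI)
    fix b assume b: "b \<in> {b \<in> beads Y. b - 1 \<notin> beads Y \<and> b mod ?n = Y u mod ?n}"
    hence "Y u mod ?n = b mod ?n" by simp
    hence dv: "?n dvd Y u - b" by (simp only: mod_eq_dvd_iff)
    then obtain a where a: "Y u - b = ?n * a" by auto
    have "b \<le> Y u" "Y v < b - 1" using b mem[OF dv] by auto
    hence "0 \<le> ?n * a" "?n * a < ?n * q" unfolding a[symmetric] q[symmetric] by linarith+
    hence "0 \<le> a" "a < q" using n0 by (simp_all add: zero_le_mult_iff)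
    moreover have "b = Y u - ?n * a" using a by simp
    ultimately show "b \<in> (\<lambda>a. Y u - ?n * a) ` {0..<q}" by auto
  next
    fix b assume "b \<in> (\<lambda>a. Y u - ?n * a) ` {0..<q}"
    then obtain a where a: "b = Y u - ?n * a" "0 \<le> a" "a < q" by auto
    have dv: "?n dvd Y u - b" using a by simp
    hence "Y u mod ?n = b mod ?n" by (simp only: mod_eq_dvd_iff)
    moreover have "0 \<le> ?n * a" "?n * a < ?n * q" using a(2,3) n0 by simp_all
    moreover have "b \<le> Y u" "\<not> b - 1 \<le> Y v" using a(1) q calculation(2,3) by linarith+
    ultimately show "b \<in> {b \<in> beads Y. b - 1 \<notin> beads Y \<and> b mod ?n = Y u mod ?n}"
      using mem[OF dv] by simp
  qed
  moreover have "card ((\<lambda>a. Y u - ?n * a) ` {0..<q}) = nat q"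
    by (subst card_image) (auto simp: inj_on_def)
  moreover have "(Y u - Y v - 1) div ?n = q" using q n0 by simp
  ultimately show ?thesis by simp
qed

text \<open>
  A residue belongs to the class of one \<open>Y u\<close>, and its predecessor to the class of
  one \<open>Y v\<close>; the count of removable boxes is the truncated quotient of \<open>Y u -
  Y v - 1\<close> by \<open>n\<close>. For \<open>m = 0\<close> the truncation would spoil the
  equivalence.
\<close>

lemma card_tight_residues:
  fixes Y :: "'n::{finite,linorder} \<Rightarrow> int"
  assumes m: "1 \<le> m" and Y: "window Y" and p: "is_partition p" "bead_set p = beads Y"
  shows "card {i \<in> {0..<int CARD('n)}. card {x \<in> removable_boxes p. residue CARD('n) x = i} = m}
       = card {(u, v). Y u - Y v = int (m * CARD('n) + 1)}"
proof -
  let ?n = "int CARD('n)"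
  have n0: "0 < ?n" by simp
  have cnt: "card {x \<in> removable_boxes p. residue CARD('n) x = Y u mod ?n} = m \<longleftrightarrow> Y u - Y v = int (m * CARD('n) + 1)"
    if d: "?n dvd Y u - Y v - 1" for u v
  proof -
    obtain q where q: "Y u - Y v - 1 = ?n * q" using d by auto
    have "nat ((Y u - Y v - 1) div ?n) = m \<longleftrightarrow> q = int m" using q n0 m by auto
    also have "\<dots> \<longleftrightarrow> ?n * q = ?n * int m" using n0 by simp
    also have "\<dots> \<longleftrightarrow> Y u - Y v = int (m * CARD('n) + 1)" using q by (auto simp: algebra_simps)
    finally show ?thesis
      using card_removable_beads[OF Y d] p by (simp add: card_removable_boxes_eq)
  qed
  define S where "S = {(u, v). Y u - Y v = int (m * CARD('n) + 1)}"
  have "{i \<in> {0..<?n}. card {x \<in> removable_boxes p. residue CARD('n) x = i} = m}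
      = (\<lambda>(u, v). Y u mod ?n) ` S"
  proof (intro equalityI subsetI)
    fix i assume i: "i \<in> {i \<in> {0..<?n}. card {x \<in> removable_boxes p. residue CARD('n) x = i} = m}"
    obtain u where "?n dvd Y u - i" using window_residue_exists[OF Y] by blast
    hence "Y u mod ?n = i mod ?n" by (simp only: mod_eq_dvd_iff)
    hence u: "Y u mod ?n = i" using i by simp
    obtain v where "?n dvd Y v - (Y u - 1)" using window_residue_exists[OF Y] by blast
    hence "?n dvd - (Y v - (Y u - 1))" by (simp only: dvd_minus_iff)
    hence "?n dvd Y u - Y v - 1" by (simp add: algebra_simps)
    from cnt[OF this, unfolded u] have "(u, v) \<in> S" using i by (simp add: S_def)
    thus "i \<in> (\<lambda>(u, v). Y u mod ?n) ` S" using u by force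
  next
    fix i assume "i \<in> (\<lambda>(u, v). Y u mod ?n) ` S"
    then obtain u v where uv: "i = Y u mod ?n" "Y u - Y v = int (m * CARD('n) + 1)" by (auto simp: S_def)
    have "?n dvd Y u - Y v - 1" using uv(2) by simp
    from cnt[OF this] uv have "card {x \<in> removable_boxes p. residue CARD('n) x = i} = m" by blast
    thus "i \<in> {i \<in> {0..<?n}. card {x \<in> removable_boxes p. residue CARD('n) x = i} = m}"
      using uv(1) by simp
  qed
  moreover have "inj_on (\<lambda>(u, v). Y u mod ?n) S"
  proof (rule inj_onI, clarify)
    fix a b c d assume s: "(a, b) \<in> S" "(c, d) \<in> S" "Y a mod ?n = Y c mod ?n"
    hence "a = c" using window_residue_inject[OF Y] by (simp add: mod_eq_dvd_iff)
    moreover have "Y b = Y d" using s \<open>a = c\<close> by (simp add: S_def)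
    hence "b = d" using window_residue_inject[OF Y, of b d] by simp
    ultimately show "a = c \<and> b = d" by simp
  qed
  ultimately show ?thesis unfolding S_def by (simp add: card_image)
qed

section \<open>Dominant regions as cells\<close>

abbreviation root_vec :: "'n \<Rightarrow> 'n \<Rightarrow> real ^ 'n" where
  "root_vec i j \<equiv> eps i - eps j"

lemma inner_root: "root_vec i j \<bullet> x = x $ i - x $ j"
  by (simp add: eps_def inner_diff_left inner_axis')

lemma inner_root_right: "x \<bullet> root_vec i j = x $ i - x $ j"
  by (simp add: inner_commute[of x] inner_root)

lemma root_nth: "root_vec i j $ a = of_bool (a = i) - of_bool (a = j)"
  by (simp add: eps_def axis_def)

lemma root_in_V_space: "root_vec i j \<in> V_space"
  unfolding V_space_def mem_Collect_eq root_nth sum_subtractf by (simp add: of_bool_def)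

lemma positive_rootE:
  assumes "a \<in> positive_roots" obtains i j where "i < j" "a = root_vec i j"
  using assms by (auto simp: positive_roots_def)

lemma root_in_positive_roots: "i < j \<Longrightarrow> root_vec i j \<in> positive_roots"
  by (auto simp: positive_roots_def)

lemma mem_root_hyperplane_iff:
  "x \<in> root_hyperplane (root_vec i j) c \<longleftrightarrow> x \<in> V_space \<and> x $ i - x $ j = of_int c"
  by (simp add: root_hyperplane_def inner_root_right)

lemma subspace_V_space: "subspace V_space"
  by (auto simp: subspace_def V_space_def sum.distrib sum_distrib_left[symmetric])

lemma closed_V_space: "closed (V_space :: (real ^ 'n) set)"
  unfolding V_space_def by (intro closed_Collect_eq continuous_intros)

text \<open>
  The orthogonal projection of \<open>W / n\<close> to \<open>V\<close>; the translation drops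
  out of all coordinate differences.
\<close>

definition centered :: "('n::finite \<Rightarrow> real) \<Rightarrow> real ^ 'n" where
  "centered W = (\<chi> i. (W i - (\<Sum>a\<in>UNIV. W a) / CARD('n)) / CARD('n))"

lemma centered_in_V_space: "centered W \<in> V_space"
  by (simp add: V_space_def centered_def sum_divide_distrib[symmetric] sum_subtractf)

lemma centered_diff:
  fixes W :: "'n::finite \<Rightarrow> real"
  shows "centered W $ i - centered W $ j = (W i - W j) / CARD('n)"
  by (simp add: centered_def diff_divide_distrib[symmetric])

text \<open>
  The conditions that membership in a region imposes on the pairs in \<open>P\<close>. The set of
  pairs is a parameter so that a single pair can be left out in the study of a wall.
\<close>

definition slabs :: "nat \<Rightarrow> ('n::finite \<Rightarrow> 'n \<Rightarrow> int) \<Rightarrow> ('n \<times> 'n) set \<Rightarrow> (real ^ 'n) set" where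
  "slabs m k P = (\<Inter>(i, j)\<in>P. {x. root_vec i j \<bullet> x > of_int (min (int m) (k i j))} \<inter>
     (if k i j < int m then {x. root_vec i j \<bullet> x < of_int (k i j) + 1} else UNIV))"

text \<open>
  The points that have, up to the height \<open>m\<close>, the prescribed integer parts of their
  coordinate differences.
\<close>

definition shi_cell :: "nat \<Rightarrow> ('n::{finite,linorder} \<Rightarrow> 'n \<Rightarrow> int) \<Rightarrow> (real ^ 'n::{finite,linorder}) set" where
  "shi_cell m k = V_space \<inter> slabs m k {(i, j). i < j}"

lemma mem_slabs_iff:
  "x \<in> slabs m k P \<longleftrightarrow> (\<forall>i j. (i, j) \<in> P \<longrightarrow> of_int (min (int m) (k i j)) < x $ i - x $ j \<and>
     (k i j < int m \<longrightarrow> x $ i - x $ j < of_int (k i j) + 1))"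
  unfolding slabs_def inner_root by auto

lemma mem_shi_cell_iff:
  "x \<in> shi_cell m k \<longleftrightarrow> x \<in> V_space \<and> (\<forall>i j. i < j \<longrightarrow>
     of_int (min (int m) (k i j)) < x $ i - x $ j \<and>
     (k i j < int m \<longrightarrow> x $ i - x $ j < of_int (k i j) + 1))"
  by (simp add: shi_cell_def mem_slabs_iff)

lemma open_slabs: "open (slabs m k P)"
  unfolding slabs_def
  by (intro open_INT) (auto intro!: open_Int open_halfspace_gt open_halfspace_lt)

lemma convex_slabs: "convex (slabs m k P)"
  unfolding slabs_def
  by (intro convex_INT) (auto intro!: convex_Int convex_halfspace_gt convex_halfspace_lt)

lemma convex_shi_cell: "convex (shi_cell m k)"
  unfolding shi_cell_def by (intro convex_Int convex_slabs subspace_imp_convex subspace_V_space)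

lemma shi_cell_cong:
  assumes "\<And>i j. i < j \<Longrightarrow> min (int m) (k i j) = min (int m) (l i j)"
  shows "shi_cell m k = shi_cell m l"
proof -
  have "k i j < int m \<longleftrightarrow> l i j < int m" "k i j < int m \<Longrightarrow> k i j = l i j" if "i < j" for i j
    using assms[OF that] by linarith+
  thus ?thesis using assms by (auto simp: mem_shi_cell_iff)
qed

text \<open>
  A cell is convex and avoids the arrangement, so it lies in one component. A connected set that
  reaches beyond a bounding hyperplane of the cell crosses that hyperplane, which belongs to the
  arrangement; so the component is not larger.
\<close>

lemma shi_cell_is_dominant_region:
  assumes m: "1 \<le> m" and x: "x \<in> shi_cell m k" and k: "\<And>i j. i < j \<Longrightarrow> 0 \<le> k i j"
  shows "shi_cell m k \<in> dominant_shi_regions m"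
proof -
  define S :: "(real ^ 'a::{finite,linorder}) set" where "S = V_space - \<Union> (shi_arrangement m)"
  have avoid: "z \<notin> S" if "i < j" "z $ i - z $ j = of_int c" "0 \<le> c" "c \<le> int m" for z i j c
  proof
    assume "z \<in> S"
    hence "z \<in> root_hyperplane (root_vec i j) c" using that by (simp add: mem_root_hyperplane_iff S_def)
    moreover have "root_hyperplane (root_vec i j) c \<in> shi_arrangement m"
      unfolding shi_arrangement_def using that m root_in_positive_roots[OF that(1)]
      by (intro CollectI exI[of _ "root_vec i j"] exI[of _ c]) auto
    ultimately show False using \<open>z \<in> S\<close> by (auto simp: S_def)
  qed
  have sub: "shi_cell m k \<subseteq> S"
  proof
    fix y assume y: "y \<in> shi_cell m k"
    have "y \<notin> H" if H: "H \<in> shi_arrangement m" for H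
    proof
      assume "y \<in> H"
      obtain a c where "a \<in> positive_roots" and ac: "H = root_hyperplane a c" "c \<le> int m"
        using H unfolding shi_arrangement_def by blast
      then obtain i j where "i < j" "a = root_vec i j" by (elim positive_rootE)
      hence ij: "i < j" "H = root_hyperplane (root_vec i j) c" "c \<le> int m" using ac by auto
      have c: "y $ i - y $ j = of_int c" using \<open>y \<in> H\<close> ij(2) by (simp add: mem_root_hyperplane_iff)
      have "of_int (min (int m) (k i j)) < (of_int c :: real)"
        "k i j < int m \<longrightarrow> (of_int c :: real) < of_int (k i j) + 1"
        using y ij(1) unfolding c[symmetric] mem_shi_cell_iff by blast+
      hence "min (int m) (k i j) < c" "k i j < int m \<longrightarrow> c < k i j + 1" by linarith+
      thus False using ij(3) by linarith
    qed
    thus "y \<in> S" using y by (auto simp: S_def shi_cell_def)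
  qed
  let ?C = "connected_component_set S x"
  have "shi_cell m k = ?C"
  proof
    show "shi_cell m k \<subseteq> ?C"
      using x sub by (intro connected_component_maximal convex_connected convex_shi_cell)
    show "?C \<subseteq> shi_cell m k"
    proof
      fix y assume y: "y \<in> ?C"
      have xC: "x \<in> ?C" using x sub by (auto simp: connected_component_refl_eq)
      have CS: "?C \<subseteq> S" by (rule connected_component_subset)
      have conn: "connected ?C" by (rule connected_connected_component)
      have cross: "\<not> (u $ i - u $ j \<le> of_int c \<and> of_int c \<le> v $ i - v $ j)"
        if ij: "i < j" and c: "0 \<le> c" "c \<le> int m" and uv: "u \<in> ?C" "v \<in> ?C" for u v i j c
      proof
        assume "u $ i - u $ j \<le> of_int c \<and> of_int c \<le> v $ i - v $ j"
        then obtain z where "z \<in> ?C" "root_vec i j \<bullet> z = of_int c"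
          using connected_ivt_hyperplane[OF conn uv, of "root_vec i j" "of_int c"]
          by (auto simp: inner_root)
        thus False using avoid[OF ij _ c, of z] CS by (auto simp: inner_root)
      qed
      have "of_int (min (int m) (k i j)) < y $ i - y $ j \<and>
          (k i j < int m \<longrightarrow> y $ i - y $ j < of_int (k i j) + 1)" if ij: "i < j" for i j
      proof (intro conjI impI)
        have xb: "of_int (min (int m) (k i j)) < x $ i - x $ j"
          "k i j < int m \<longrightarrow> x $ i - x $ j < of_int (k i j) + 1"
          using x ij by (auto simp: mem_shi_cell_iff)
        show "of_int (min (int m) (k i j)) < y $ i - y $ j"
          using cross[OF ij _ _ y xC, of "min (int m) (k i j)"] xb(1) k[OF ij] by force
        assume "k i j < int m"
        thus "y $ i - y $ j < of_int (k i j) + 1"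
          using cross[OF ij _ _ xC y, of "k i j + 1"] xb(2) k[OF ij] by force
      qed
      moreover have "y \<in> V_space" using y CS by (auto simp: S_def)
      ultimately show "y \<in> shi_cell m k" by (simp add: mem_shi_cell_iff)
    qed
  qed
  moreover have "x \<in> S" using x sub by blast
  ultimately have "shi_cell m k \<in> components S" by (auto simp: components_def)
  hence "shi_cell m k \<in> shi_regions m" by (simp add: shi_regions_def S_def)
  moreover have "shi_cell m k \<subseteq> dominant_chamber"
  proof
    fix y assume y: "y \<in> shi_cell m k"
    have "0 \<le> y $ i - y $ j" if "i < j" for i j
    proof -
      have "of_int (min (int m) (k i j)) < y $ i - y $ j" using y that by (simp add: mem_shi_cell_iff)
      moreover have "0 \<le> (of_int (min (int m) (k i j)) :: real)" using k[OF that] by simp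
      ultimately show ?thesis by linarith
    qed
    thus "y \<in> dominant_chamber"
      using y by (auto simp: dominant_chamber_def simple_roots_def mem_shi_cell_iff inner_root_right)
  qed
  ultimately show ?thesis by (simp add: dominant_shi_regions_def)
qed

text \<open>A positive root is a sum of simple roots.\<close>

lemma dominant_chamber_antimono:
  assumes "x \<in> dominant_chamber" "i < j"
  shows "x $ j \<le> x $ i"
  using assms(2)
proof (induction "card {i<..<j}" arbitrary: i j rule: less_induct)
  case less
  show ?case
  proof (cases "\<exists>l. i < l \<and> l < j")
    case False
    hence "root_vec i j \<in> simple_roots" using less(2) by (auto simp: simple_roots_def)
    hence "0 \<le> x \<bullet> root_vec i j" using assms(1) by (simp add: dominant_chamber_def)
    thus ?thesis by (simp add: inner_root_right)
  next
    case True
    then obtain l where l: "i < l" "l < j" by blast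
    have "card {i<..<l} < card {i<..<j}" "card {l<..<j} < card {i<..<j}"
      using l by (auto intro!: psubset_card_mono)
    hence "x $ l \<le> x $ i" "x $ j \<le> x $ l" using less(1) l by blast+
    thus ?thesis by simp
  qed
qed

lemma dominant_region_is_shi_cell:
  assumes m: "1 \<le> m" and R: "R \<in> dominant_shi_regions m"
  shows "\<exists>x :: real ^ 'n::{finite,linorder}. (\<forall>i j. i < j \<longrightarrow> x $ j < x $ i) \<and>
    (\<forall>i j c. i < j \<longrightarrow> 0 \<le> c \<longrightarrow> c \<le> int m \<longrightarrow> x $ i - x $ j \<noteq> of_int c) \<and>
    R = shi_cell m (\<lambda>i j. \<lfloor>x $ i - x $ j\<rfloor>)"
proof -
  define S :: "(real ^ 'n::{finite,linorder}) set" where "S = V_space - \<Union> (shi_arrangement m)"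
  have RS: "R \<in> components S" and dom: "R \<subseteq> dominant_chamber"
    using R by (auto simp: dominant_shi_regions_def shi_regions_def S_def)
  obtain x where x: "x \<in> R" using in_components_nonempty[OF RS] by blast
  have xS: "x \<in> S" using x in_components_subset[OF RS] by blast
  have off: "x $ i - x $ j \<noteq> of_int c" if "i < j" "0 \<le> c" "c \<le> int m" for i j c
  proof
    assume "x $ i - x $ j = of_int c"
    hence "x \<in> root_hyperplane (root_vec i j) c" using xS by (simp add: mem_root_hyperplane_iff S_def)
    moreover have "root_hyperplane (root_vec i j) c \<in> shi_arrangement m"
      unfolding shi_arrangement_def using that m root_in_positive_roots[OF that(1)]
      by (intro CollectI exI[of _ "root_vec i j"] exI[of _ c]) auto
    ultimately show False using xS by (auto simp: S_def)
  qed
  have dec: "x $ j < x $ i" if "i < j" for i j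
    using dominant_chamber_antimono[of x i j] x dom off[OF that, of 0] that by force
  define k where "k = (\<lambda>i j. \<lfloor>x $ i - x $ j\<rfloor>)"
  have "x \<in> shi_cell m k"
  proof -
    have "of_int (min (int m) (k i j)) < x $ i - x $ j" if "i < j" for i j
    proof -
      have "0 \<le> k i j" using dec[OF that] by (simp add: k_def)
      hence "x $ i - x $ j \<noteq> of_int (min (int m) (k i j))" by (intro off that) auto
      moreover have "of_int (min (int m) (k i j)) \<le> x $ i - x $ j"
        unfolding k_def by (simp add: le_floor_iff[symmetric])
      ultimately show ?thesis by linarith
    qed
    moreover have "x $ i - x $ j < of_int (k i j) + 1" for i j
      unfolding k_def by linarith
    ultimately show ?thesis using xS by (simp add: mem_shi_cell_iff S_def)
  qed
  hence "shi_cell m k \<in> dominant_shi_regions m"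
    by (intro shi_cell_is_dominant_region[OF m, of x]) (use dec in \<open>auto simp: k_def less_imp_le\<close>)
  hence "shi_cell m k \<in> components S"
    by (simp add: dominant_shi_regions_def shi_regions_def S_def)
  hence "R = shi_cell m k"
    using components_eq[OF RS] x \<open>x \<in> shi_cell m k\<close> by blast
  thus ?thesis using dec off unfolding k_def by blast
qed

text \<open>
  Only the levels cut off at \<open>m\<close> matter, and these take finitely many values.
\<close>

lemma finite_dominant_shi_regions:
  assumes "1 \<le> m"
  shows "finite (dominant_shi_regions m :: (real ^ 'n::{finite,linorder}) set set)"
proof -
  let ?K = "{k :: 'n \<Rightarrow> 'n \<Rightarrow> int. \<forall>i j. k i j \<in> {0..int m}}"
  have "?K = PiE UNIV (\<lambda>_. PiE UNIV (\<lambda>_. {0..int m}))" by (simp add: PiE_UNIV_domain Pi_def)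
  hence "finite ?K" by (simp add: finite_PiE)
  moreover have "dominant_shi_regions m \<subseteq> shi_cell m ` ?K"
  proof
    fix R :: "(real ^ 'n::{finite,linorder}) set" assume "R \<in> dominant_shi_regions m"
    then obtain x :: "real ^ 'n::{finite,linorder}" where x: "\<forall>i j. i < j \<longrightarrow> x $ j < x $ i"
        "R = shi_cell m (\<lambda>i j. \<lfloor>x $ i - x $ j\<rfloor>)"
      using dominant_region_is_shi_cell[OF assms] by blast
    define k where "k = (\<lambda>i j. max 0 (min (int m) \<lfloor>x $ i - x $ j\<rfloor>))"
    have "0 \<le> \<lfloor>x $ i - x $ j\<rfloor>" if "i < j" for i j using x(1) that by (simp add: less_imp_le)
    hence "R = shi_cell m k" unfolding x(2) by (intro shi_cell_cong) (simp add: k_def)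
    moreover have "k \<in> ?K" by (simp add: k_def)
    ultimately show "R \<in> shi_cell m ` ?K" by blast
  qed
  ultimately show ?thesis by (meson finite_imageI finite_subset)
qed

section \<open>Walls of cells\<close>

text \<open>
  \<open>Y i - Y j\<close> is not a multiple of \<open>n\<close>, so after division by
  \<open>n\<close> its distance from the nearest integer is at least \<open>1 / n\<close>.
\<close>

lemma level_strict_bounds:
  fixes Y :: "'n::{finite,linorder} \<Rightarrow> int"
  assumes "window Y" "i \<noteq> j"
  shows "of_int (level Y i j) + 1 / CARD('n) \<le> (of_int (Y i) - of_int (Y j)) / (CARD('n) :: real)"
    and "(of_int (Y i) - of_int (Y j)) / (CARD('n) :: real) \<le> of_int (level Y i j) + 1 - 1 / CARD('n)"
proof -
  let ?n = "int CARD('n)"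
  have "(Y i - Y j) mod ?n \<noteq> 0" using assms window_residue_inject[OF assms(1)] by auto
  moreover have "0 \<le> (Y i - Y j) mod ?n" "(Y i - Y j) mod ?n < ?n" by auto
  moreover have "Y i - Y j = ?n * level Y i j + (Y i - Y j) mod ?n" by (simp add: level_def)
  ultimately have "?n * level Y i j + 1 \<le> Y i - Y j" "Y i - Y j \<le> ?n * level Y i j + ?n - 1"
    by linarith+
  hence *: "real_of_int (?n * level Y i j + 1) \<le> of_int (Y i - Y j)"
    "real_of_int (Y i - Y j) \<le> of_int (?n * level Y i j + ?n - 1)" by linarith+
  have "of_int (level Y i j) + 1 / real CARD('n) = of_int (?n * level Y i j + 1) / CARD('n)"
    by (simp add: add_divide_distrib)
  also have "\<dots> \<le> of_int (Y i - Y j) / CARD('n)" using *(1) by (rule divide_right_mono) simp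
  finally show "of_int (level Y i j) + 1 / CARD('n) \<le> (of_int (Y i) - of_int (Y j)) / (CARD('n) :: real)"
    by simp
  have "of_int (Y i - Y j) / CARD('n) \<le> real_of_int (?n * level Y i j + ?n - 1) / CARD('n)"
    using *(2) by (rule divide_right_mono) simp
  also have "\<dots> = of_int (level Y i j) + 1 - 1 / real CARD('n)"
    by (simp add: add_divide_distrib diff_divide_distrib)
  finally show "(of_int (Y i) - of_int (Y j)) / (CARD('n) :: real) \<le> of_int (level Y i j) + 1 - 1 / CARD('n)"
    by simp
qed

lemma window_point_in_cell:
  fixes Y :: "'n::{finite,linorder} \<Rightarrow> int"
  assumes "window Y"
  shows "centered (\<lambda>i. of_int (Y i)) \<in> shi_cell m (level Y)"
proof -
  have "of_int (min (int m) (level Y i j)) < (of_int (Y i) - of_int (Y j)) / real CARD('n)"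
    "(of_int (Y i) - of_int (Y j)) / real CARD('n) < of_int (level Y i j) + 1" if "i < j" for i j
  proof -
    have "0 < 1 / real CARD('n)" by simp
    moreover have "real_of_int (min (int m) (level Y i j)) \<le> of_int (level Y i j)" by simp
    ultimately show "of_int (min (int m) (level Y i j)) < (of_int (Y i) - of_int (Y j)) / real CARD('n)"
      "(of_int (Y i) - of_int (Y j)) / real CARD('n) < of_int (level Y i j) + 1"
      using level_strict_bounds[OF assms less_imp_neq[OF that]] by linarith+
  qed
  thus ?thesis unfolding mem_shi_cell_iff centered_diff by (simp add: centered_in_V_space)
qed

lemma closure_shi_cell_ge_level:
  fixes Y :: "'n::{finite,linorder} \<Rightarrow> int"
  assumes "2 \<le> CARD('n)" "window Y" "gap_bounded m Y" "x \<in> closure (shi_cell m (level Y))" "i < j"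
  shows "of_int (level Y i j) \<le> x $ i - x $ j"
proof -
  have "shi_cell m (level Y) \<subseteq> {x. root_vec i j \<bullet> x \<ge> of_int (level Y i j)}"
  proof
    fix x assume "x \<in> shi_cell m (level Y)"
    hence "of_int (level Y i j) < x $ i - x $ j"
      by (intro level_less_of_truncated[OF assms(2,3,1) _ assms(5), where x = "\<lambda>i. x $ i"])
         (simp add: mem_shi_cell_iff)
    thus "x \<in> {x. root_vec i j \<bullet> x \<ge> of_int (level Y i j)}" by (simp add: inner_root)
  qed
  hence "closure (shi_cell m (level Y)) \<subseteq> {x. root_vec i j \<bullet> x \<ge> of_int (level Y i j)}"
    by (rule closure_minimal) (rule closed_halfspace_ge)
  thus ?thesis using assms(4) by (auto simp: inner_root)
qed

lemma closure_shi_cell_subset_V_space: "closure (shi_cell m k) \<subseteq> V_space"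
  by (rule closure_minimal) (auto simp: shi_cell_def closed_V_space)

lemma aff_dim_closure_shi_cell:
  fixes k :: "'n::{finite,linorder} \<Rightarrow> 'n \<Rightarrow> int"
  assumes "x \<in> shi_cell m k"
  shows "aff_dim (closure (shi_cell m k)) = aff_dim (V_space :: (real ^ 'n::{finite,linorder}) set)"
proof -
  have "affine hull (shi_cell m k) = affine hull V_space"
    unfolding shi_cell_def
    by (rule affine_hull_affine_Int_open)
       (use assms in \<open>auto simp: shi_cell_def open_slabs subspace_imp_affine subspace_V_space\<close>)
  hence "aff_dim (shi_cell m k) = aff_dim (V_space :: (real ^ 'n::{finite,linorder}) set)"
    by (metis aff_dim_affine_hull)
  thus ?thesis by simp
qed

text \<open>
  As \<open>c \<noteq> 0\<close>, the origin of \<open>V\<close> is not on the hyperplane.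
\<close>

lemma aff_dim_V_space_Int_hyperplane:
  assumes "x \<in> V_space" "x $ i - x $ j = c" "c \<noteq> 0"
  shows "aff_dim (V_space \<inter> {x :: real ^ 'n. root_vec i j \<bullet> x = c}) = aff_dim (V_space :: (real ^ 'n) set) - 1"
proof -
  have "x \<in> V_space \<inter> {x. root_vec i j \<bullet> x = c}" using assms by (simp add: inner_root)
  moreover have "\<not> V_space \<subseteq> {x. root_vec i j \<bullet> x = c}"
    using assms(3) subspace_0[OF subspace_V_space] by auto
  ultimately show ?thesis
    by (subst aff_dim_affine_Int_hyperplane) (auto simp: subspace_imp_affine subspace_V_space)
qed

text \<open>
  For a pair that is not tight, the split \<open>m = level Y i l + level Y l j\<close> shows that
  equality for \<open>(i, j)\<close> on the closure of the cell forces equality for \<open>(i,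
  l)\<close>. The wall would then lie in the intersection of two different hyperplanes of
  \<open>V\<close>, whose dimension is too small for a facet.
\<close>

lemma wall_imp_tight:
  fixes Y :: "'n::{finite,linorder} \<Rightarrow> int"
  assumes n: "2 \<le> CARD('n)" and m: "1 \<le> m" and Y: "window Y" "gap_bounded m Y"
    and ij: "i < j" and lev: "int m \<le> level Y i j"
    and wall: "contains_wall (root_hyperplane (root_vec i j) (int m)) (shi_cell m (level Y))"
  shows "Y i - Y j = int (m * CARD('n) + 1)"
proof -
  let ?V = "V_space :: (real ^ 'n::{finite,linorder}) set"
  define R where "R = shi_cell m (level Y)"
  note ge = closure_shi_cell_ge_level[OF n Y, folded R_def]
  obtain F where F: "F facet_of closure R" "F \<subseteq> root_hyperplane (root_vec i j) (int m)"
    using wall unfolding contains_wall_def R_def by blast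
  have Fsub: "F \<subseteq> closure R" using F(1) facet_of_imp_subset by blast
  have Fne: "F \<noteq> {}" and Fdim: "aff_dim F = aff_dim ?V - 1"
    using F(1) aff_dim_closure_shi_cell[OF window_point_in_cell[OF Y(1)], of m]
    by (auto simp: facet_of_def R_def)
  have Fval: "x \<in> V_space" "x $ i - x $ j = of_int (int m)" if "x \<in> F" for x
    using F(2) that by (auto simp: mem_root_hyperplane_iff)
  obtain f where f: "f \<in> F" using Fne by blast
  have "of_int (level Y i j) \<le> f $ i - f $ j" using ge[OF _ ij] f Fsub by blast
  hence "level Y i j \<le> int m" using Fval(2)[OF f] by simp
  hence lm: "level Y i j = int m" using lev by simp
  have "\<not> int (m * CARD('n) + 1) < Y i - Y j"
  proof
    assume "int (m * CARD('n) + 1) < Y i - Y j"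
    then obtain l where l: "i < l" "l < j" "int m = level Y i l + level Y l j"
      using level_split[OF Y ij] lm by metis
    define H where "H = ?V \<inter> {x. root_vec i j \<bullet> x = of_int (int m)}"
    define K where "K = {x. root_vec i l \<bullet> x = of_int (level Y i l)}"
    have FHK: "F \<subseteq> H \<inter> K"
    proof
      fix x assume x: "x \<in> F"
      have "of_int (level Y i l) \<le> x $ i - x $ l" "of_int (level Y l j) \<le> x $ l - x $ j"
        using ge x Fsub l by blast+
      moreover have "x $ i - x $ j = of_int (level Y i l) + of_int (level Y l j)"
        using Fval(2)[OF x] l(3) by simp
      ultimately have "x $ i - x $ l = of_int (level Y i l)" by linarith
      thus "x \<in> H \<inter> K" using Fval[OF x] by (simp add: H_def K_def inner_root)
    qed
    have affH: "affine H" unfolding H_def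
      by (intro affine_Int affine_hyperplane subspace_imp_affine subspace_V_space)
    have "\<not> H \<subseteq> K"
    proof
      assume "H \<subseteq> K"
      \<comment> \<open>This displacement keeps the difference of the coordinates \<open>i\<close> and \<open>j\<close> and moves the coordinate \<open>l\<close> against both.\<close>
      define g where "g = f + (root_vec i l + root_vec j l)"
      have "g \<in> V_space" unfolding g_def
        by (intro subspace_add subspace_V_space root_in_V_space Fval(1) f)
      moreover have "g $ i - g $ j = f $ i - f $ j" "g $ i - g $ l = f $ i - f $ l + 3"
        using l ij by (auto simp: g_def eps_def axis_def)
      ultimately have "g \<in> H" "g \<notin> K"
        using Fval[OF f] FHK f by (auto simp: H_def K_def inner_root)
      thus False using \<open>H \<subseteq> K\<close> by blast
    qed
    moreover have "H \<inter> K \<noteq> {}" using FHK f by blast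
    ultimately have "aff_dim (H \<inter> K) = aff_dim H - 1"
      using affH unfolding K_def by (subst aff_dim_affine_Int_hyperplane) auto
    also have "aff_dim H = aff_dim ?V - 1"
      unfolding H_def using Fval[OF f] m by (intro aff_dim_V_space_Int_hyperplane[of f]) auto
    finally have "aff_dim F \<le> aff_dim ?V - 1 - 1" using aff_dim_subset[OF FHK] by simp
    thus False using Fdim by simp
  qed
  moreover have "int (m * CARD('n) + 1) \<le> Y i - Y j"
  proof -
    have "int CARD('n) * int m \<le> Y i - Y j" using lm
      by (metis level_def mult_div_mod_eq le_add_same_cancel1 pos_mod_sign of_nat_0_less_iff zero_less_card_finite)
    moreover have "Y i - Y j \<noteq> int CARD('n) * int m"
      using window_residue_inject[OF Y(1), of i j] ij by auto
    ultimately show ?thesis by (simp add: algebra_simps)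
  qed
  ultimately show ?thesis by linarith
qed

lemma tight_imp_level:
  fixes Y :: "'n::{finite,linorder} \<Rightarrow> int"
  assumes "2 \<le> CARD('n)" "window Y" "Y i - Y j = int (m * CARD('n) + 1)"
  shows "i < j" "level Y i j = int m"
proof -
  have "Y j < Y i" using assms(3) by (smt (verit) of_nat_0_le_iff of_nat_add of_nat_1)
  thus "i < j" using window_less_iff[OF assms(2)] by blast
  show "level Y i j = int m"
    unfolding level_def assms(3) using assms(1) by (intro int_div_pos_eq[of _ _ _ 1]) auto
qed

text \<open>
  Lowering the coordinate \<open>i\<close> of the window by \<open>1/2\<close> and raising the coordinate \<open>j\<close> by \<open>1/2\<close> gives a
  point on the hyperplane. Each other difference of values changes by at most \<open>1/2\<close>, so all other
  inequalities of the cell remain strict. Thus a relatively open part of the hyperplane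
  lies in the closure of the cell.
\<close>

lemma tight_imp_wall:
  fixes Y :: "'n::{finite,linorder} \<Rightarrow> int"
  assumes n: "2 \<le> CARD('n)" and m: "1 \<le> m" and Y: "window Y" "gap_bounded m Y"
    and tight: "Y i - Y j = int (m * CARD('n) + 1)"
  shows "contains_wall (root_hyperplane (root_vec i j) (int m)) (shi_cell m (level Y))"
proof -
  let ?V = "V_space :: (real ^ 'n::{finite,linorder}) set"
  note ij = tight_imp_level(1)[OF n Y(1) tight] and lev = tight_imp_level(2)[OF n Y(1) tight]
  define R where "R = shi_cell m (level Y)"
  define U where "U = slabs m (level Y) ({(a, b). a < b} - {(i, j)})"
  define H where "H = ?V \<inter> {x. root_vec i j \<bullet> x = real m}"
  define F where "F = closure R \<inter> {x. root_vec i j \<bullet> x = real m}"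
  have R_eq: "z \<in> R" if "z \<in> V_space" "z \<in> U" "real m < root_vec i j \<bullet> z" for z
    unfolding R_def mem_shi_cell_iff
  proof (intro conjI allI impI)
    fix a b :: 'n assume ab: "a < b"
    have "(of_int (min (int m) (level Y a b)) < z $ a - z $ b) \<and>
      (level Y a b < int m \<longrightarrow> z $ a - z $ b < of_int (level Y a b) + 1)"
    proof (cases "(a, b) = (i, j)")
      case True
      thus ?thesis using that(3) lev by (simp add: inner_root)
    next
      case False
      hence "(a, b) \<in> {(a, b). a < b} - {(i, j)}" using ab by blast
      thus ?thesis using that(2) unfolding U_def mem_slabs_iff by blast
    qed
    thus "of_int (min (int m) (level Y a b)) < z $ a - z $ b"
      "level Y a b < int m \<Longrightarrow> z $ a - z $ b < of_int (level Y a b) + 1" by auto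
  qed (rule that(1))
  have near: "y \<in> closure R" if "y \<in> H \<inter> U" for y
    unfolding closure_approachable
  proof (intro allI impI)
    fix e :: real assume "0 < e"
    have "open U" unfolding U_def by (rule open_slabs)
    moreover have "y \<in> U" using that by blast
    ultimately obtain d where d: "0 < d" "ball y d \<subseteq> U" by (rule openE)
    \<comment> \<open>A root has length at most \<open>2\<close>, so the displaced point stays within \<open>d\<close> and \<open>e\<close> of \<open>y\<close>.\<close>
    define t where "t = min d e / 4"
    define z where "z = y + t *\<^sub>R root_vec i j"
    have t: "0 < t" "t * 2 < d" "t * 2 < e" using d(1) \<open>0 < e\<close> by (auto simp: t_def)
    have "norm (root_vec i j :: real ^ 'n::{finite,linorder}) \<le> 2"
      using norm_triangle_ineq4[of "eps i :: real ^ 'n::{finite,linorder}" "eps j"] by (simp add: eps_def)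
    hence "t * norm (root_vec i j :: real ^ 'n::{finite,linorder}) \<le> t * 2" using t(1) by simp
    hence dist: "dist z y \<le> t * 2" using t(1) by (simp add: z_def dist_norm)
    have "z \<in> U" using dist t(2) d(2) by (auto simp: dist_commute)
    moreover have "z \<in> V_space" using that unfolding z_def H_def
      by (intro subspace_add subspace_scale subspace_V_space root_in_V_space) auto
    moreover have "root_vec i j \<bullet> z = real m + t * 2"
    proof -
      have "y $ i - y $ j = real m" using that by (simp add: H_def inner_root)
      thus ?thesis using ij unfolding inner_root by (simp add: z_def eps_def axis_def)
    qed
    ultimately have "z \<in> R" using t(1) by (intro R_eq) auto
    thus "\<exists>z\<in>R. dist z y < e" using dist t(3) by (intro bexI[of _ z]) auto
  qed
  define W where "W = (\<lambda>a. real_of_int (Y a) - of_bool (a = i) / 2 + of_bool (a = j) / 2)"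
  define x where "x = centered W"
  have n0: "0 < real CARD('n)" by simp
  have "x \<in> H"
  proof -
    have "W i - W j = real m * real CARD('n)"
    proof -
      have "real_of_int (Y i - Y j) = real (m * CARD('n) + 1)" using tight by (metis of_int_of_nat_eq)
      thus ?thesis using ij by (simp add: W_def)
    qed
    thus ?thesis by (simp add: H_def x_def centered_in_V_space inner_root centered_diff)
  qed
  moreover have "x \<in> U"
    unfolding U_def mem_slabs_iff
  proof (intro allI impI)
    fix a b assume ab: "(a, b) \<in> {(a, b). a < b} - {(i, j)}"
    define D where "D = (real_of_int (Y a) - of_int (Y b)) / CARD('n)"
    have "\<bar>(W a - W b) - (of_int (Y a) - of_int (Y b))\<bar> \<le> 1 / 2"
      using ab ij by (auto simp: W_def)
    hence "\<bar>((W a - W b) - (of_int (Y a) - of_int (Y b))) / CARD('n)\<bar> \<le> (1 / 2) / CARD('n)"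
      by (simp add: abs_divide divide_right_mono del: divide_divide_eq_left)
    moreover have "((W a - W b) - (of_int (Y a) - of_int (Y b))) / CARD('n) = (x $ a - x $ b) - D"
      by (simp add: D_def x_def centered_diff diff_divide_distrib)
    moreover have "(1 / 2) / real CARD('n) < 1 / real CARD('n)"
      by (rule divide_strict_right_mono[OF _ n0]) simp
    moreover have "of_int (level Y a b) + 1 / CARD('n) \<le> D" "D \<le> of_int (level Y a b) + 1 - 1 / CARD('n)"
      using level_strict_bounds[OF Y(1), of a b] ab by (auto simp: D_def)
    ultimately have "of_int (level Y a b) < x $ a - x $ b" "x $ a - x $ b < of_int (level Y a b) + 1"
      by linarith+
    moreover have "real_of_int (min (int m) (level Y a b)) \<le> of_int (level Y a b)" by simp
    ultimately show "of_int (min (int m) (level Y a b)) < x $ a - x $ b \<and>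
        (level Y a b < int m \<longrightarrow> x $ a - x $ b < of_int (level Y a b) + 1)"
      by linarith
  qed
  ultimately have xHU: "x \<in> H \<inter> U" by blast
  have "F face_of closure R"
    unfolding F_def
  proof (rule face_of_Int_supporting_hyperplane_ge)
    show "convex (closure R)" by (simp add: R_def convex_shi_cell convex_closure)
    show "real m \<le> root_vec i j \<bullet> x" if "x \<in> closure R" for x
      using closure_shi_cell_ge_level[OF n Y that[unfolded R_def] ij] lev by (simp add: inner_root)
  qed
  moreover have "F \<noteq> {}" using near xHU by (auto simp: F_def H_def)
  moreover have "aff_dim F = aff_dim (closure R) - 1"
  proof -
    have H_dim: "aff_dim H = aff_dim ?V - 1"
      unfolding H_def using xHU m
      by (intro aff_dim_V_space_Int_hyperplane[of x]) (auto simp: H_def inner_root)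
    have "affine H" unfolding H_def
      by (intro affine_Int affine_hyperplane subspace_imp_affine subspace_V_space)
    hence "affine hull (H \<inter> U) = affine hull H"
      using xHU by (intro affine_hull_affine_Int_open) (auto simp: U_def open_slabs)
    hence "aff_dim (H \<inter> U) = aff_dim H" by (metis aff_dim_affine_hull)
    moreover have "H \<inter> U \<subseteq> F" using near by (auto simp: F_def H_def)
    moreover have "F \<subseteq> H" using closure_shi_cell_subset_V_space by (auto simp: F_def H_def R_def)
    ultimately have "aff_dim F = aff_dim H" using aff_dim_subset by (metis antisym)
    thus ?thesis
      using H_dim aff_dim_closure_shi_cell[OF window_point_in_cell[OF Y(1)], of m] by (simp add: R_def)
  qed
  ultimately have "F facet_of closure R" by (simp add: facet_of_def)
  moreover have "F \<subseteq> root_hyperplane (root_vec i j) (int m)"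
    using closure_shi_cell_subset_V_space[of m "level Y"]
    by (auto simp: F_def R_def mem_root_hyperplane_iff inner_root)
  ultimately show ?thesis unfolding contains_wall_def R_def by blast
qed

lemma fundamental_alcove_bounds:
  assumes "x \<in> fundamental_alcove" "i < j"
  shows "x $ i - x $ j < 1"
proof -
  have dom: "x \<in> dominant_chamber"
    using assms(1) by (auto simp: fundamental_alcove_def dominant_chamber_def less_imp_le)
  have le: "x $ b \<le> x $ a" if "a \<le> b" for a b
    using dominant_chamber_antimono[OF dom, of a b] that by (cases "a = b") auto
  have "x $ i \<le> x $ Min UNIV" "x $ Max UNIV \<le> x $ j" by (intro le; simp)+
  moreover have "x $ Min UNIV - x $ Max UNIV < 1"
    using assms(1) by (simp add: fundamental_alcove_def highest_root_def inner_root_right)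
  ultimately show ?thesis by linarith
qed

lemma fundamental_alcove_nonempty: "(fundamental_alcove :: (real ^ 'n::{finite,linorder}) set) \<noteq> {}"
proof -
  define x where "x = centered (\<lambda>i :: 'n. - real (card {..<i}))"
  have diff: "x $ i - x $ j = (real (card {..<j}) - real (card {..<i})) / CARD('n)" for i j
    by (simp add: x_def centered_diff)
  have "card {..<i} < card {..<j}" if "i < j" for i j :: 'n
    using that by (intro psubset_card_mono) auto
  hence pos: "0 < x $ i - x $ j" if "i < j" for i j using that by (simp add: diff)
  have "card {..<Max UNIV :: 'n} < CARD('n)" by (intro psubset_card_mono) auto
  hence "x $ Min UNIV - x $ Max UNIV < 1" by (simp add: diff)
  hence "x \<in> fundamental_alcove"
    using pos by (auto simp: fundamental_alcove_def simple_roots_def highest_root_def x_def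
        centered_in_V_space inner_root_right)
  thus ?thesis by blast
qed

text \<open>
  The point \<open>m (\<epsilon>\<^sub>i - \<epsilon>\<^sub>j) / 2\<close> lies on the first
  hyperplane. It lies on the second one only if the two roots, which have the same length, have
  inner product \<open>2\<close>, that is, are equal.
\<close>

lemma root_hyperplane_inject:
  assumes "root_hyperplane (root_vec i j) (int m) = root_hyperplane (root_vec a b) (int m)" "1 \<le> m" "i \<noteq> j"
  shows "i = a \<and> j = b"
proof -
  define x where "x = (real m / 2) *\<^sub>R root_vec i j"
  have "x \<in> V_space" unfolding x_def by (intro subspace_scale subspace_V_space root_in_V_space)
  moreover have "x $ i - x $ j = real m" using assms(3) by (simp add: x_def eps_def axis_def)
  ultimately have "x \<in> root_hyperplane (root_vec i j) (int m)" by (simp add: mem_root_hyperplane_iff)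
  hence "x $ a - x $ b = real m" unfolding assms(1) by (simp add: mem_root_hyperplane_iff)
  thus ?thesis using assms(2,3) by (auto simp: x_def eps_def axis_def split: if_splits)
qed

lemma card_separating_walls:
  fixes Y :: "'n::{finite,linorder} \<Rightarrow> int"
  assumes n: "2 \<le> CARD('n)" and m: "1 \<le> m" and Y: "window Y" "gap_bounded m Y"
  shows "card (separating_walls m (shi_cell m (level Y))) = card {(i, j). Y i - Y j = int (m * CARD('n) + 1)}"
proof -
  define S where "S = {(i, j). Y i - Y j = int (m * CARD('n) + 1)}"
  define R where "R = shi_cell m (level Y)"
  note S_level = tight_imp_level[OF n Y(1)]
  have "separating_walls m R = (\<lambda>(i, j). root_hyperplane (root_vec i j) (int m)) ` S"
  proof (intro equalityI subsetI)
    fix H assume "H \<in> separating_walls m R"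
    then obtain i j where ij: "i < j" and H: "H = root_hyperplane (root_vec i j) (int m)"
      and sep: "separates (root_vec i j) (int m) R fundamental_alcove"
      and wall: "contains_wall H R"
      by (auto simp: separating_walls_def elim!: positive_rootE)
    obtain y :: "real ^ 'n::{finite,linorder}" where y: "y \<in> fundamental_alcove"
      using fundamental_alcove_nonempty by blast
    have "y \<bullet> root_vec i j < of_int (int m)"
      using fundamental_alcove_bounds[OF y ij] m by (simp add: inner_root_right)
    hence above: "\<forall>x\<in>R. of_int (int m) < x \<bullet> root_vec i j" using sep y by (force simp: separates_def)
    define x where "x = centered (\<lambda>a. real_of_int (Y a))"
    have x: "x \<in> R" unfolding x_def R_def by (rule window_point_in_cell[OF Y(1)])
    have "int m \<le> level Y i j"
    proof (rule ccontr)
      assume "\<not> int m \<le> level Y i j"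
      hence "x $ i - x $ j < of_int (level Y i j) + 1" "level Y i j + 1 \<le> int m"
        using x ij by (auto simp: R_def mem_shi_cell_iff)
      moreover have "real m < x $ i - x $ j" using above x by (simp add: inner_root_right)
      ultimately show False by linarith
    qed
    hence "(i, j) \<in> S"
      using wall_imp_tight[OF n m Y ij] wall by (simp add: S_def H R_def)
    thus "H \<in> (\<lambda>(i, j). root_hyperplane (root_vec i j) (int m)) ` S" using H by force
  next
    fix H assume "H \<in> (\<lambda>(i, j). root_hyperplane (root_vec i j) (int m)) ` S"
    then obtain i j where ij: "Y i - Y j = int (m * CARD('n) + 1)"
      and H: "H = root_hyperplane (root_vec i j) (int m)" by (auto simp: S_def)
    have "x \<bullet> root_vec i j > of_int (int m)" if "x \<in> R" for x
    proof -
      have "of_int (min (int m) (level Y i j)) < x $ i - x $ j"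
        using that S_level(1)[OF ij] unfolding R_def mem_shi_cell_iff by blast
      thus ?thesis using S_level(2)[OF ij] by (simp add: inner_root_right)
    qed
    moreover have "y \<bullet> root_vec i j < of_int (int m)" if "y \<in> fundamental_alcove" for y
      using fundamental_alcove_bounds[OF that S_level(1)[OF ij]] m
      by (simp add: inner_root_right)
    ultimately have "separates (root_vec i j) (int m) R fundamental_alcove"
      by (auto simp: separates_def)
    moreover have "contains_wall H R" unfolding H R_def by (rule tight_imp_wall[OF n m Y ij])
    ultimately show "H \<in> separating_walls m R"
      using root_in_positive_roots[OF S_level(1)[OF ij]] H by (auto simp: separating_walls_def)
  qed
  moreover have "inj_on (\<lambda>(i, j). root_hyperplane (root_vec i j) (int m)) S"
  proof (rule inj_onI, clarify)
    fix a b c d assume s: "(a, b) \<in> S" "(c, d) \<in> S"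
      "root_hyperplane (root_vec a b) (int m) = root_hyperplane (root_vec c d) (int m)"
    have "a < b" using s(1) S_level(1) by (simp add: S_def)
    thus "a = c \<and> b = d" using root_hyperplane_inject[OF s(3) m] by simp
  qed
  ultimately show ?thesis unfolding S_def R_def by (simp add: card_image)
qed

section \<open>Cores and dominant regions\<close>

text \<open>Any point of the region gives a window, and descending makes it gap-bounded.\<close>

lemma dominant_region_has_window:
  assumes n: "2 \<le> CARD('n::{finite,linorder})" and m: "1 \<le> m"
    and R: "R \<in> (dominant_shi_regions m :: (real ^ 'n::{finite,linorder}) set set)"
  shows "\<exists>Y :: 'n \<Rightarrow> int. window Y \<and> gap_bounded m Y \<and> R = shi_cell m (level Y)"
proof -
  obtain x :: "real ^ 'n::{finite,linorder}" where x: "\<forall>i j. i < j \<longrightarrow> x $ j < x $ i"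
      "\<forall>i j c. i < j \<longrightarrow> 0 \<le> c \<longrightarrow> c \<le> int m \<longrightarrow> x $ i - x $ j \<noteq> of_int c"
      "R = shi_cell m (\<lambda>i j. \<lfloor>x $ i - x $ j\<rfloor>)"
    using dominant_region_is_shi_cell[OF m R] by blast
  obtain Y :: "'n \<Rightarrow> int" where Y: "window Y"
      "\<forall>i j. i < j \<longrightarrow> min (int m) (level Y i j) = min (int m) \<lfloor>x $ i - x $ j\<rfloor>"
    using window_of_point[of "\<lambda>i. x $ i" m] x(1,2) by blast
  obtain Z :: "'n \<Rightarrow> int" where Z: "window Z" "gap_bounded m Z"
      "\<forall>a b. a < b \<longrightarrow> min (int m) (level Z a b) = min (int m) (level Y a b)"
    using gap_bounded_representative[OF n Y(1)] by blast
  have "R = shi_cell m (level Z)" unfolding x(3) using Y(2) Z(3) by (intro shi_cell_cong) simp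
  thus ?thesis using Z by blast
qed

text \<open>
  The centre of the alcove of \<open>Z\<close> lies in the cell of \<open>Y\<close>, so the
  levels of \<open>Y\<close> are lower bounds for those of \<open>Z\<close>. By symmetry all
  levels agree.
\<close>

lemma shi_cell_level_inject:
  fixes Y Z :: "'n::{finite,linorder} \<Rightarrow> int"
  assumes n: "2 \<le> CARD('n)" and Y: "window Y" "gap_bounded m Y" and Z: "window Z" "gap_bounded m Z"
    and eq: "shi_cell m (level Y) = shi_cell m (level Z)"
  shows "\<exists>c. \<forall>i. Z i = Y i + c"
proof -
  have le: "level Y i j \<le> level Z i j"
    if "window Y" "gap_bounded m Y" "window Z" "shi_cell m (level Y) = shi_cell m (level Z)" "i < j"
    for Y Z :: "'n \<Rightarrow> int" and i j
  proof -
    define x where "x = centered (\<lambda>i. real_of_int (Z i))"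
    have "x \<in> shi_cell m (level Z)" unfolding x_def by (rule window_point_in_cell[OF that(3)])
    hence "x \<in> closure (shi_cell m (level Y))" unfolding that(4) by (rule subsetD[OF closure_subset])
    hence "of_int (level Y i j) \<le> x $ i - x $ j"
      by (rule closure_shi_cell_ge_level[OF n that(1,2) _ that(5)])
    also have "\<dots> = (of_int (Z i) - of_int (Z j)) / CARD('n)" by (simp add: x_def centered_diff)
    also have "\<dots> \<le> of_int (level Z i j) + 1 - 1 / CARD('n)"
      by (rule level_strict_bounds[OF that(3) less_imp_neq[OF that(5)]])
    also have "\<dots> < of_int (level Z i j) + 1" by simp
    finally show ?thesis by linarith
  qed
  show ?thesis
    by (rule level_eq_imp_shift[OF Y(1) Z(1)])
       (intro antisym le[OF Y Z(1) eq] le[OF Z Y(1) eq[symmetric]])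
qed

definition window_of :: "nat list \<Rightarrow> 'n::{finite,linorder} \<Rightarrow> int" where
  "window_of p = (SOME Y. window Y \<and> beads Y = bead_set p)"

lemma window_of_core_props:
  assumes "is_core CARD('n::{finite,linorder}) p"
  shows "window (window_of p :: 'n \<Rightarrow> int)" "beads (window_of p :: 'n \<Rightarrow> int) = bead_set p"
  unfolding window_of_def using someI_ex[OF window_of_core[OF assms]] by auto

lemma window_of_eq:
  fixes Y :: "'n::{finite,linorder} \<Rightarrow> int"
  assumes "window Y" "beads Y = bead_set p" "is_core CARD('n) p"
  shows "window_of p = Y"
  using window_of_core_props[OF assms(3)] assms(1,2) by (intro beads_inject) auto

lemma gap_bounded_window_of_iff:
  assumes "is_core CARD('n::{finite,linorder}) p"
  shows "gap_bounded m (window_of p :: 'n \<Rightarrow> int) \<longleftrightarrow> is_core (m * CARD('n) + 1) p"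
proof -
  have "is_partition p" using assms by (simp add: is_core_def)
  thus ?thesis
    using beads_closed_iff_gap_bounded[OF window_of_core_props(1)[OF assms], of m]
    by (simp add: is_core_iff_closed window_of_core_props(2)[OF assms])
qed

lemma bij_betw_cores_dominant_regions:
  assumes n: "2 \<le> CARD('n::{finite,linorder})" and m: "1 \<le> m"
  shows "bij_betw (\<lambda>p. shi_cell m (level (window_of p :: 'n \<Rightarrow> int)))
    {p. is_core CARD('n) p \<and> is_core (m * CARD('n) + 1) p}
    (dominant_shi_regions m :: (real ^ 'n::{finite,linorder}) set set)"
  (is "bij_betw ?f ?C _")
  unfolding bij_betw_def
proof
  show "inj_on ?f ?C"
  proof (rule inj_onI)
    fix p q assume p: "p \<in> ?C" and q: "q \<in> ?C" and eq: "?f p = ?f q"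
    let ?Y = "window_of p :: 'n \<Rightarrow> int" and ?Z = "window_of q :: 'n \<Rightarrow> int"
    have Y: "window ?Y" "gap_bounded m ?Y" "beads ?Y = bead_set p"
      and Z: "window ?Z" "gap_bounded m ?Z" "beads ?Z = bead_set q"
      using p q by (simp_all add: window_of_core_props gap_bounded_window_of_iff)
    obtain c where "\<forall>i. ?Z i = ?Y i + c" using shi_cell_level_inject[OF n Y(1,2) Z(1,2) eq] by blast
    hence "?Z = (\<lambda>i. ?Y i + c)" by blast
    hence "bead_set q = (\<lambda>b. b + c) ` bead_set p" using Y(3) Z(3) beads_shift[of ?Y c] by simp
    thus "p = q" using bead_set_shift_inject[of q p c] p q by (simp add: is_core_def)
  qed
  show "?f ` ?C = dominant_shi_regions m"
  proof (intro equalityI subsetI)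
    fix R assume "R \<in> ?f ` ?C"
    then obtain p where p: "p \<in> ?C" and R: "R = ?f p" by blast
    have w: "window (window_of p :: 'n \<Rightarrow> int)" using p by (simp add: window_of_core_props)
    show "R \<in> dominant_shi_regions m"
      unfolding R by (rule shi_cell_is_dominant_region[OF m window_point_in_cell[OF w] level_nonneg[OF w]])
  next
    fix R :: "(real ^ 'n::{finite,linorder}) set" assume "R \<in> dominant_shi_regions m"
    then obtain Y :: "'n \<Rightarrow> int" where Y: "window Y" "gap_bounded m Y" "R = shi_cell m (level Y)"
      using dominant_region_has_window[OF n m] by blast
    obtain p c where p: "is_core CARD('n) p" "bead_set p = beads (\<lambda>i. Y i + c)"
      using core_of_window[OF Y(1)] by blast
    have w: "window_of p = (\<lambda>i. Y i + c)"
      by (rule window_of_eq[OF window_shift[OF Y(1)] p(2)[symmetric] p(1)])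
    have "is_core (m * CARD('n) + 1) p"
      using gap_bounded_window_of_iff[OF p(1), of m] Y(2) by (simp add: w gap_bounded_shift)
    moreover have "?f p = R" by (simp add: w level_shift Y(3))
    ultimately show "R \<in> ?f ` ?C" using p(1) by blast
  qed
qed

theorem corollary8p5:
  fixes m k :: nat
  assumes "CARD('n::{finite,linorder}) \<ge> 2" and "m \<ge> 1"
  shows "finite {p. is_core CARD('n) p \<and> is_core (m * CARD('n) + 1) p \<and>
             (\<exists>K \<subseteq> {0..<int CARD('n)}. card K = k \<and>
               (\<forall>i\<in>{0..<int CARD('n)}.
                 card {x \<in> removable_boxes p. residue CARD('n) x = i} = m \<longleftrightarrow> i \<in> K))} \<and>
         narayana TYPE('n) m k =
           card {p. is_core CARD('n) p \<and> is_core (m * CARD('n) + 1) p \<and>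
             (\<exists>K \<subseteq> {0..<int CARD('n)}. card K = k \<and>
               (\<forall>i\<in>{0..<int CARD('n)}.
                 card {x \<in> removable_boxes p. residue CARD('n) x = i} = m \<longleftrightarrow> i \<in> K))}"
proof -
  let ?f = "\<lambda>p. shi_cell m (level (window_of p :: 'n \<Rightarrow> int))"
  let ?C = "{p. is_core CARD('n) p \<and> is_core (m * CARD('n) + 1) p}"
  let ?tight = "\<lambda>p. {i \<in> {0..<int CARD('n)}. card {x \<in> removable_boxes p. residue CARD('n) x = i} = m}"
  let ?P = "{p. is_core CARD('n) p \<and> is_core (m * CARD('n) + 1) p \<and>
             (\<exists>K \<subseteq> {0..<int CARD('n)}. card K = k \<and>
               (\<forall>i\<in>{0..<int CARD('n)}.
                 card {x \<in> removable_boxes p. residue CARD('n) x = i} = m \<longleftrightarrow> i \<in> K))}"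
  let ?N = "{R \<in> dominant_shi_regions m :: (real ^ 'n::{finite,linorder}) set set. card (separating_walls m R) = k}"
  note bij = bij_betw_cores_dominant_regions[OF assms]
  have K_iff: "(\<exists>K \<subseteq> {0..<int CARD('n)}. card K = k \<and>
       (\<forall>i\<in>{0..<int CARD('n)}. card {x \<in> removable_boxes p. residue CARD('n) x = i} = m \<longleftrightarrow> i \<in> K))
     \<longleftrightarrow> card (?tight p) = k" for p
  proof
    assume "\<exists>K \<subseteq> {0..<int CARD('n)}. card K = k \<and>
       (\<forall>i\<in>{0..<int CARD('n)}. card {x \<in> removable_boxes p. residue CARD('n) x = i} = m \<longleftrightarrow> i \<in> K)"
    then obtain K where K: "K \<subseteq> {0..<int CARD('n)}" "card K = k"
      "\<forall>i\<in>{0..<int CARD('n)}. card {x \<in> removable_boxes p. residue CARD('n) x = i} = m \<longleftrightarrow> i \<in> K" by blast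
    have "?tight p = K" using K(1,3) by blast
    thus "card (?tight p) = k" using K(2) by simp
  qed (intro exI[of _ "?tight p"], blast)
  have P: "?P = {p \<in> ?C. card (?tight p) = k}" unfolding K_iff by blast
  have cnt: "card (?tight p) = card (separating_walls m (?f p))" if "p \<in> ?C" for p
  proof -
    let ?Y = "window_of p :: 'n \<Rightarrow> int"
    have Y: "window ?Y" "gap_bounded m ?Y" "bead_set p = beads ?Y"
      using that by (simp_all add: window_of_core_props gap_bounded_window_of_iff)
    have "is_partition p" using that by (simp add: is_core_def)
    thus ?thesis
      using card_tight_residues[OF assms(2) Y(1) _ Y(3)] card_separating_walls[OF assms Y(1,2)] by simp
  qed
  have "?f ` ?P = ?N"
  proof -
    have "?f ` ?P = {R \<in> ?f ` ?C. card (separating_walls m R) = k}"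
      unfolding P using cnt by auto
    thus ?thesis using bij by (simp add: bij_betw_def)
  qed
  moreover have inj: "inj_on ?f ?P"
    using bij by (rule inj_on_subset[OF bij_betw_imp_inj_on]) (use P in blast)
  ultimately have bijP: "bij_betw ?f ?P ?N" by (simp add: bij_betw_def)
  have "finite ?N" by (rule finite_subset[OF _ finite_dominant_shi_regions[OF assms(2)]]) blast
  hence "finite ?P" using bij_betw_finite[OF bijP] by blast
  moreover have "card ?N = card ?P" by (rule bij_betw_same_card[OF bijP, symmetric])
  ultimately show ?thesis unfolding narayana_def by (rule conjI)
qed

end
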